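(* Let $(L,\leq)$ be a free $I$-semilattice with "fat" intervals and let $G_L$ be its compatibility graph. Then the graph complex $\Lambda(G_L)$ is $\mathbb{Z}_2$-homotopy equivalent to the order complex $\Delta(L)$ (with the involution induced by $C$).
   Context: A (finite) semilattice is a finite poset $L$ which is the proper part of the finite lattice $\widehat L=L\cup\{\widehat0,\widehat1\}$. A free $I$-semilattice is a semilattice $L$ with a monotone involution $C:L\to L$ ($C\circ C=\mathrm{id}$, $x\leq y\Rightarrow C(x)\leq C(y)$) such that no $x\in L$ satisfies $x\leq C(x)$. $L$ has "fat" intervals if for every strict chain $x<z<y$ in $L$ there is $z'$ with $x\leq z'\leq y$ incomparable to $z$. The compatibility graph $G_L$ has vertex set $L$, with $x,y$ adjacent iff $y\leq C(x)$ or $x\leq C(y)$. For a finite graph $G$ with vertex set $V$ and $A\subseteq V$, let $CN(A)$ be the set of common neighbours of all vertices of $A$. Let $P_G$ be the poset (under inclusion) of nonempty $A\subseteq V$ with $CN(A)\neq\emptyset$, and $\mathcal{L}(P_G)=\{A\in P_G\mid CN(CN(A))=A\}$, with the order-reversing involution $A\mapsto CN(A)$. The graph complex $\Lambda(G)$ is the $\mathbb{Z}_2$-homotopy type of the order complex $\Delta(\mathcal{L}(P_G))$ with the induced involution (equivalently of the box poset $\{(A,B)\in P_G\times P_G\mid A\subseteq CN(B), B\subseteq CN(A)\}$ with the swap involution). $\mathbb{Z}_2$-homotopy equivalence means equivariant maps both ways with composites equivariantly homotopic to identities. *)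

theory Defs
  imports "HOL-Algebra.Lattice" "HOL-Analysis.Analysis"
begin

section \<open>Semilattices with a free involution\<close>

datatype 'a hat = Hat0 | Elt 'a | Hat1

fun hat_le :: "('a, 'm) gorder_scheme \<Rightarrow> 'a hat \<Rightarrow> 'a hat \<Rightarrow> bool" where
  "hat_le L Hat0 b \<longleftrightarrow> True"
| "hat_le L (Elt x) Hat0 \<longleftrightarrow> False"
| "hat_le L (Elt x) (Elt y) \<longleftrightarrow> x \<sqsubseteq>\<^bsub>L\<^esub> y"
| "hat_le L (Elt x) Hat1 \<longleftrightarrow> True"
| "hat_le L Hat1 b \<longleftrightarrow> b = Hat1"

definition hat_poset :: "('a, 'm) gorder_scheme \<Rightarrow> 'a hat gorder" where
  "hat_poset L = \<lparr>carrier = {Hat0, Hat1} \<union> Elt ` carrier L, eq = (=), le = hat_le L\<rparr>"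

text \<open>A finite lattice with distinct least and greatest elements is isomorphic to
  \<^term>\<open>hat_poset L\<close> for its proper part \<open>L\<close>.\<close>

definition finite_semilattice :: "('a, 'm) gorder_scheme \<Rightarrow> bool" where
  "finite_semilattice L \<longleftrightarrow>
     finite (carrier L) \<and> partial_order L \<and> Lattice.lattice (hat_poset L)"

definition monotone_involution :: "('a, 'm) gorder_scheme \<Rightarrow> ('a \<Rightarrow> 'a) \<Rightarrow> bool" where
  "monotone_involution L C \<longleftrightarrow>
     (\<forall>x\<in>carrier L. C x \<in> carrier L \<and> C (C x) = x) \<and>
     (\<forall>x\<in>carrier L. \<forall>y\<in>carrier L. x \<sqsubseteq>\<^bsub>L\<^esub> y \<longrightarrow> C x \<sqsubseteq>\<^bsub>L\<^esub> C y)"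

definition free_I_semilattice :: "('a, 'm) gorder_scheme \<Rightarrow> ('a \<Rightarrow> 'a) \<Rightarrow> bool" where
  "free_I_semilattice L C \<longleftrightarrow>
     finite_semilattice L \<and> monotone_involution L C \<and>
     \<not> (\<exists>x\<in>carrier L. x \<sqsubseteq>\<^bsub>L\<^esub> C x)"

definition comparable :: "('a, 'm) gorder_scheme \<Rightarrow> 'a \<Rightarrow> 'a \<Rightarrow> bool" where
  "comparable L x y \<longleftrightarrow> x \<sqsubseteq>\<^bsub>L\<^esub> y \<or> y \<sqsubseteq>\<^bsub>L\<^esub> x"

definition fat_intervals :: "('a, 'm) gorder_scheme \<Rightarrow> bool" where
  "fat_intervals L \<longleftrightarrow>
     (\<forall>x\<in>carrier L. \<forall>z\<in>carrier L. \<forall>y\<in>carrier L. x \<sqsubset>\<^bsub>L\<^esub> z \<and> z \<sqsubset>\<^bsub>L\<^esub> y \<longrightarrow>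
        (\<exists>z'\<in>carrier L. x \<sqsubseteq>\<^bsub>L\<^esub> z' \<and> z' \<sqsubseteq>\<^bsub>L\<^esub> y \<and> \<not> comparable L z z'))"


section \<open>$\mathbb{Z}_2$-spaces and $\mathbb{Z}_2$-homotopy equivalence\<close>

text \<open>The involution is only relevant on the points of the space.\<close>

type_synonym 'p z2_space = "'p topology \<times> ('p \<Rightarrow> 'p)"

definition is_z2_space :: "'p z2_space \<Rightarrow> bool" where
  "is_z2_space X \<longleftrightarrow>
     continuous_map (fst X) (fst X) (snd X) \<and>
     (\<forall>p\<in>topspace (fst X). snd X (snd X p) = p)"

definition equivariant :: "'p z2_space \<Rightarrow> 'q z2_space \<Rightarrow> ('p \<Rightarrow> 'q) \<Rightarrow> bool" where
  "equivariant X Y f \<longleftrightarrow> (\<forall>p\<in>topspace (fst X). f (snd X p) = snd Y (f p))"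

definition z2_map :: "'p z2_space \<Rightarrow> 'q z2_space \<Rightarrow> ('p \<Rightarrow> 'q) \<Rightarrow> bool" where
  "z2_map X Y f \<longleftrightarrow> continuous_map (fst X) (fst Y) f \<and> equivariant X Y f"

definition z2_homotopic :: "'p z2_space \<Rightarrow> 'q z2_space \<Rightarrow> ('p \<Rightarrow> 'q) \<Rightarrow> ('p \<Rightarrow> 'q) \<Rightarrow> bool" where
  "z2_homotopic X Y = homotopic_with (equivariant X Y) (fst X) (fst Y)"

definition z2_homotopy_equivalent :: "'p z2_space \<Rightarrow> 'q z2_space \<Rightarrow> bool" where
  "z2_homotopy_equivalent X Y \<longleftrightarrow>
     is_z2_space X \<and> is_z2_space Y \<and>
     (\<exists>f g. z2_map X Y f \<and> z2_map Y X g \<and>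
            z2_homotopic X X (g \<circ> f) id \<and> z2_homotopic Y Y (f \<circ> g) id)"


section \<open>Order complexes\<close>

definition chains :: "('a, 'm) gorder_scheme \<Rightarrow> 'a set set" where
  "chains P = {s. finite s \<and> s \<noteq> {} \<and> s \<subseteq> carrier P \<and> (\<forall>x\<in>s. \<forall>y\<in>s. comparable P x y)}"

text \<open>Geometric realization in barycentric coordinates. The topology is the subspace topology
  of the product topology, which is the usual one for a finite complex.\<close>

definition realization :: "'v set set \<Rightarrow> ('v \<Rightarrow> real) topology" where
  "realization K = top_of_set
     {t. (\<forall>v. 0 \<le> t v) \<and> {v. t v \<noteq> 0} \<in> K \<and> (\<Sum>v | t v \<noteq> 0. t v) = 1}"

text \<open>Affine extension of a vertex map \<open>\<phi>\<close>, i.e. the point \<open>\<Sum>v. t v * e\<^sub>v\<close> is sent to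
  \<open>\<Sum>v. t v * e\<^sub>w\<close> with \<open>w = \<phi> v\<close>.\<close>

definition affine_extension ::
    "'v set \<Rightarrow> ('v \<Rightarrow> 'w) \<Rightarrow> ('v \<Rightarrow> real) \<Rightarrow> ('w \<Rightarrow> real)" where
  "affine_extension V \<phi> t = (\<lambda>w. \<Sum>v | v \<in> V \<and> \<phi> v = w. t v)"

text \<open>The involution \<open>\<phi>\<close> may preserve or reverse the order; either way it maps chains to chains.\<close>

definition order_complex :: "('a, 'm) gorder_scheme \<Rightarrow> ('a \<Rightarrow> 'a) \<Rightarrow> ('a \<Rightarrow> real) z2_space" where
  "order_complex P \<phi> = (realization (chains P), affine_extension (carrier P) \<phi>)"


section \<open>Graph complexes\<close>

text \<open>A graph is a pair of a vertex set and a symmetric adjacency relation on it.\<close>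

type_synonym 'a graph = "'a set \<times> ('a \<times> 'a) set"

definition compatibility_graph :: "('a, 'm) gorder_scheme \<Rightarrow> ('a \<Rightarrow> 'a) \<Rightarrow> 'a graph" where
  "compatibility_graph L C =
     (carrier L,
      {(x, y). x \<in> carrier L \<and> y \<in> carrier L \<and> (y \<sqsubseteq>\<^bsub>L\<^esub> C x \<or> x \<sqsubseteq>\<^bsub>L\<^esub> C y)})"

definition CN :: "'a graph \<Rightarrow> 'a set \<Rightarrow> 'a set" where
  "CN G A = {v \<in> fst G. \<forall>a\<in>A. (a, v) \<in> snd G}"

definition P_graph :: "'a graph \<Rightarrow> 'a set set" where
  "P_graph G = {A. A \<noteq> {} \<and> A \<subseteq> fst G \<and> CN G A \<noteq> {}}"

definition closed_poset :: "'a graph \<Rightarrow> 'a set gorder" where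
  "closed_poset G = \<lparr>carrier = {A \<in> P_graph G. CN G (CN G A) = A}, eq = (=), le = (\<subseteq>)\<rparr>"

definition graph_complex :: "'a graph \<Rightarrow> ('a set \<Rightarrow> real) z2_space" where
  "graph_complex G = order_complex (closed_poset G) (CN G)"

end

theory Submission
  imports Defs
begin

text \<open>Write \<open>N A\<close> for the set of elements comparable to all of \<open>A\<close>. Since \<open>x\<close> and \<open>y\<close> are adjacent in
  the compatibility graph iff \<open>y\<close> is comparable to \<open>C x\<close>, the closed sets are the \<open>A\<close> with
  \<open>N (N A) = A\<close>, and their involution is \<open>A \<mapsto> C ` N A\<close>. For a closed set \<open>A\<close> the chain \<open>A \<inter> N A\<close> is
  nonempty because \<open>L\<close> is a semilattice, and for a flag \<open>F\<close> of closed sets \<open>core F\<close>, the union of the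
  \<open>A \<inter> N A\<close> with \<open>A \<in> F\<close>, is still a chain of \<open>L\<close>; conversely a chain \<open>s\<close> of \<open>L\<close> gives the flag
  \<open>N (N s) \<subseteq> N s\<close>. Both assignments are equivariant and yield maps \<open>f\<close>, \<open>g\<close> on barycentric
  subdivisions. A straight line connects \<open>f \<circ> g\<close> with the identity. For \<open>g \<circ> f\<close> one compares, on flags
  \<open>a \<subseteq> b\<close>, the intervals \<open>[N (N (core a)), N (core a)]\<close> and \<open>[\<Inter>b, \<Union>b]\<close> with an equivariantly chosen
  interval contained in both; after enough subdivision the homotopies are again straight lines.\<close>

section \<open>Points of a realization\<close>

definition supp :: "('v \<Rightarrow> real) \<Rightarrow> 'v set" where
  "supp t = {v. t v \<noteq> 0}"

text \<open>This is the full simplex on \<open>V\<close>. A complex with vertices in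
  \<open>V\<close> is cut out of it by a condition on \<open>supp\<close>, so maps can be built once
  on the whole simplex.\<close>

definition dists :: "'v set \<Rightarrow> ('v \<Rightarrow> real) set" where
  "dists V = {t. (\<forall>v. 0 \<le> t v) \<and> supp t \<subseteq> V \<and> sum t V = 1}"

lemma supp_nonempty: "t \<in> dists V \<Longrightarrow> supp t \<noteq> {}"
  by (auto simp: dists_def supp_def) (metis sum.neutral zero_neq_one)

text \<open>Coordinates outside the support vanish, so the total mass may be summed over the fixed
  finite set \<open>V\<close> instead of a support that varies with the point.\<close>

lemma realization_eq:
  assumes "finite V" "K \<subseteq> Pow V"
  shows "realization K = top_of_set {t \<in> dists V. supp t \<in> K}"
proof -
  have "sum t (supp t) = sum t V" if "supp t \<subseteq> V" for t :: "'a \<Rightarrow> real"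
    using that assms(1) by (intro sum.mono_neutral_left) (auto simp: supp_def)
  then have "{t. (\<forall>v. 0 \<le> t v) \<and> supp t \<in> K \<and> sum t (supp t) = 1} = {t \<in> dists V. supp t \<in> K}"
    using assms(2) by (auto simp: dists_def)
  then show ?thesis by (simp add: realization_def supp_def)
qed

section \<open>Involutions of the vertex set and their affine extensions\<close>

definition involution_on :: "'v set \<Rightarrow> ('v \<Rightarrow> 'v) \<Rightarrow> bool" where
  "involution_on V \<phi> \<longleftrightarrow> (\<forall>v\<in>V. \<phi> v \<in> V \<and> \<phi> (\<phi> v) = v)"

lemma involution_onD:
  assumes "involution_on V \<phi>" "v \<in> V"
  shows "\<phi> v \<in> V" "\<phi> (\<phi> v) = v"
  using assms by (auto simp: involution_on_def)

lemma involution_on_bij: "involution_on V \<phi> \<Longrightarrow> bij_betw \<phi> V V"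
  by (rule bij_betw_byWitness[where f' = \<phi>]) (auto simp: involution_on_def)

lemma involution_on_image:
  assumes "involution_on V \<phi>"
  shows "involution_on (Pow V - {{}}) (image \<phi>)"
proof -
  have "\<phi> ` \<phi> ` s = s" if "s \<subseteq> V" for s
  proof -
    have "\<phi> ` \<phi> ` s = id ` s" unfolding image_image
      by (rule image_cong) (use that involution_onD(2)[OF assms] in auto)
    then show ?thesis by simp
  qed
  then show ?thesis
    using involution_onD(1)[OF assms] by (auto simp: involution_on_def)
qed

text \<open>The fibre of an involution over a vertex is a single vertex, so the push-forward of
  masses becomes a pull-back along \<open>\<phi>\<close>.\<close>

lemma affine_extension_involution:
  assumes "involution_on V \<phi>"
  shows "affine_extension V \<phi> t = (\<lambda>w. if w \<in> V then t (\<phi> w) else 0)"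
proof
  fix w
  have "{v \<in> V. \<phi> v = w} = (if w \<in> V then {\<phi> w} else {})"
    using assms unfolding involution_on_def by (auto; metis)
  then show "affine_extension V \<phi> t w = (if w \<in> V then t (\<phi> w) else 0)"
    by (simp add: affine_extension_def)
qed

lemma supp_affine_extension:
  assumes "involution_on V \<phi>" "supp t \<subseteq> V"
  shows "supp (affine_extension V \<phi> t) = \<phi> ` supp t"
proof
  show "supp (affine_extension V \<phi> t) \<subseteq> \<phi> ` supp t"
  proof
    fix w assume "w \<in> supp (affine_extension V \<phi> t)"
    then have "w \<in> V" "\<phi> w \<in> supp t"
      by (auto simp: supp_def affine_extension_involution[OF assms(1)] split: if_splits)
    then show "w \<in> \<phi> ` supp t" using involution_onD(2)[OF assms(1)] by force
  qed
  show "\<phi> ` supp t \<subseteq> supp (affine_extension V \<phi> t)"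
    using assms by (auto simp: supp_def affine_extension_involution[OF assms(1)] involution_on_def)
qed

lemma affine_extension_dists:
  assumes "involution_on V \<phi>" "t \<in> dists V"
  shows "affine_extension V \<phi> t \<in> dists V"
proof -
  have "sum (\<lambda>w. if w \<in> V then t (\<phi> w) else 0) V = sum (\<lambda>w. t (\<phi> w)) V"
    by (rule sum.cong) auto
  also have "\<dots> = sum t V"
    by (rule sum.reindex_bij_betw) (rule involution_on_bij[OF assms(1)])
  finally show ?thesis using assms(2)
    by (auto simp: dists_def affine_extension_involution[OF assms(1)] supp_def split: if_splits)
qed

lemma continuous_on_coordinate: "continuous_on S (\<lambda>t :: 'v \<Rightarrow> real. t v)"
  by (rule continuous_on_subset[OF continuous_on_product_coordinates]) simp

lemma continuous_on_affine_extension: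
  assumes "finite V" shows "continuous_on S (affine_extension V \<phi>)"
  unfolding affine_extension_def
  by (rule continuous_on_coordinatewise_then_product, rule continuous_on_sum,
      rule continuous_on_coordinate)

lemma is_z2_space_realization:
  assumes "finite V" "K \<subseteq> Pow V" "involution_on V \<phi>" "\<And>s. s \<in> K \<Longrightarrow> \<phi> ` s \<in> K"
  shows "is_z2_space (realization K, affine_extension V \<phi>)"
proof -
  have "affine_extension V \<phi> (affine_extension V \<phi> t) = t" if "t \<in> dists V" for t
    using that assms(3)
    by (auto simp: dists_def supp_def affine_extension_involution[OF assms(3)] involution_on_def fun_eq_iff)
  moreover have "supp (affine_extension V \<phi> t) \<in> K" if "t \<in> dists V" "supp t \<in> K" for t
    using that assms supp_affine_extension[OF assms(3)] by (auto simp: dists_def)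
  ultimately show ?thesis
    unfolding is_z2_space_def realization_eq[OF assms(1,2)]
    by (auto simp: continuous_on_affine_extension assms affine_extension_dists)
qed

text \<open>Two points whose supports span a common simplex are joined by a segment inside it;
  \<open>sub\<close> enters because a point of the segment may have a smaller support than the
  union. Affine extensions commute with convex combinations, so every stage of the homotopy is
  equivariant.\<close>

lemma z2_homotopic_straight_line:
  fixes X :: "('s::topological_space) z2_space" and V :: "'v set"
  assumes fin: "finite V" and K: "K \<subseteq> Pow V"
    and sub: "\<And>s s'. s \<in> K \<Longrightarrow> s' \<subseteq> s \<Longrightarrow> s' \<noteq> {} \<Longrightarrow> s' \<in> K"
    and X: "fst X = top_of_set S"
    and f: "z2_map X (realization K, affine_extension V \<psi>) f"
    and g: "z2_map X (realization K, affine_extension V \<psi>) g"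
    and fg: "\<And>t. t \<in> S \<Longrightarrow> supp (f t) \<union> supp (g t) \<in> K"
  shows "z2_homotopic X (realization K, affine_extension V \<psi>) f g"
proof -
  define h :: "real \<times> 's \<Rightarrow> 'v \<Rightarrow> real"
    where "h p = (\<lambda>v. (1 - fst p) * f (snd p) v + fst p * g (snd p) v)" for p
  have cf: "continuous_on S f" "\<And>t. t \<in> S \<Longrightarrow> f t \<in> dists V"
    and cg: "continuous_on S g" "\<And>t. t \<in> S \<Longrightarrow> g t \<in> dists V"
    using f g by (auto simp: z2_map_def X realization_eq[OF fin K])
  have "continuous_on ({0..1} \<times> S) (\<lambda>p. f (snd p) v)"
       "continuous_on ({0..1} \<times> S) (\<lambda>p. g (snd p) v)" for v
    by (rule continuous_on_compose2[OF continuous_on_product_then_coordinatewise[OF cf(1)]]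
             continuous_on_compose2[OF continuous_on_product_then_coordinatewise[OF cg(1)]];
        auto intro: continuous_intros)+
  then have "continuous_on ({0..1} \<times> S) (\<lambda>p. h p v)" for v
    unfolding h_def by (intro continuous_intros) auto
  then have ch: "continuous_on ({0..1} \<times> S) h"
    by (rule continuous_on_coordinatewise_then_product)
  have hd: "h (r, t) \<in> dists V \<and> supp (h (r, t)) \<in> K" if "r \<in> {0..1}" "t \<in> S" for r t
  proof -
    have "sum (h (r, t)) V = (1 - r) * sum (f t) V + r * sum (g t) V"
      by (simp add: h_def sum.distrib sum_distrib_left)
    moreover have "supp (h (r, t)) \<subseteq> supp (f t) \<union> supp (g t)"
      by (auto simp: h_def supp_def)
    moreover have "0 \<le> h (r, t) v" for v
      using cf(2)[OF that(2)] cg(2)[OF that(2)] that(1) by (simp add: dists_def h_def)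
    moreover have "sum (f t) V = 1" "sum (g t) V = 1" "supp (f t) \<subseteq> V" "supp (g t) \<subseteq> V"
      using cf(2)[OF that(2)] cg(2)[OF that(2)] by (simp_all add: dists_def)
    ultimately have hdV: "h (r, t) \<in> dists V"
      unfolding dists_def by (intro CollectI conjI allI) auto
    with \<open>supp (h (r, t)) \<subseteq> _\<close> show ?thesis
      using sub[OF fg[OF that(2)]] supp_nonempty[OF hdV] by simp
  qed
  have eq: "h (r, snd X t) = affine_extension V \<psi> (h (r, t))" if "t \<in> S" for r t
    using f g that
    by (simp add: z2_map_def equivariant_def X h_def affine_extension_def fun_eq_iff
        sum.distrib sum_distrib_left)
  show ?thesis
    unfolding z2_homotopic_def homotopic_with_def X fst_conv realization_eq[OF fin K]
  proof (intro exI[of _ h] conjI allI ballI)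
    show "continuous_map (prod_topology (top_of_set {0..1}) (top_of_set S))
        (top_of_set {t \<in> dists V. supp t \<in> K}) h"
      using ch hd by auto
    show "h (0, t) = f t" "h (1, t) = g t" for t
      by (simp_all add: h_def)
    show "equivariant X (top_of_set {t \<in> dists V. supp t \<in> K}, affine_extension V \<psi>) (\<lambda>t. h (r, t))" for r
      using eq by (simp add: equivariant_def X)
  qed
qed


section \<open>Spreading mass and subdivision\<close>

text \<open>The affine map sending the vertex \<open>v\<close> to the barycenter of \<open>S v\<close>.\<close>

definition spread :: "'v set \<Rightarrow> ('v \<Rightarrow> 'w set) \<Rightarrow> ('v \<Rightarrow> real) \<Rightarrow> 'w \<Rightarrow> real" where
  "spread V S t = (\<lambda>w. \<Sum>v\<in>V. t v * (if w \<in> S v then 1 / real (card (S v)) else 0))"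

lemma continuous_on_spread: "continuous_on A (spread V S)"
  unfolding spread_def
  by (rule continuous_on_coordinatewise_then_product, rule continuous_on_sum,
      rule continuous_on_mult_right, rule continuous_on_coordinate)

text \<open>All summands are nonnegative, so nothing cancels and the supports simply unite. The
  weights on each charged \<open>S v\<close> add up to one, so the total mass is preserved.\<close>

lemma
  assumes "finite V" "finite W" "t \<in> dists V"
    and S: "\<And>v. v \<in> supp t \<Longrightarrow> S v \<noteq> {} \<and> S v \<subseteq> W"
  shows supp_spread: "supp (spread V S t) = (\<Union>v\<in>supp t. S v)"
    and spread_dists: "spread V S t \<in> dists W"
proof -
  have nn: "0 \<le> t v" for v using assms(3) by (simp add: dists_def)
  have tV: "supp t \<subseteq> V" using assms(3) by (simp add: dists_def)
  have fS: "finite (S v)" if "v \<in> supp t" for v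
    by (rule finite_subset[OF _ assms(2)]) (simp add: S that)
  have pos: "0 \<le> t v * (if w \<in> S v then 1 / real (card (S v)) else 0)" for v w
    using nn by simp
  show s: "supp (spread V S t) = (\<Union>v\<in>supp t. S v)"
  proof (rule Set.set_eqI)
    fix w
    have "w \<in> supp (spread V S t) \<longleftrightarrow> (\<exists>v\<in>V. t v \<noteq> 0 \<and> w \<in> S v \<and> card (S v) \<noteq> 0)"
      by (simp add: supp_def spread_def sum_nonneg_eq_0_iff[OF assms(1) pos] Bex_def) blast
    also have "\<dots> \<longleftrightarrow> (\<exists>v\<in>supp t. w \<in> S v)"
    proof -
      have "card (S v) \<noteq> 0" if "v \<in> supp t" for v
        using fS[OF that] S[OF that] by simp
      moreover have "v \<in> V" if "v \<in> supp t" for v using tV that by blast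
      moreover have "t v \<noteq> 0 \<longleftrightarrow> v \<in> supp t" for v by (simp add: supp_def)
      ultimately show ?thesis by meson
    qed
    finally show "w \<in> supp (spread V S t) \<longleftrightarrow> w \<in> (\<Union>v\<in>supp t. S v)" by simp
  qed
  have "sum (spread V S t) W = (\<Sum>v\<in>V. t v * (\<Sum>w\<in>W. if w \<in> S v then 1 / real (card (S v)) else 0))"
    unfolding spread_def by (subst sum.swap) (simp add: sum_distrib_left)
  also have "\<dots> = (\<Sum>v\<in>V. t v)"
  proof (rule sum.cong[OF refl])
    fix v assume "v \<in> V"
    show "t v * (\<Sum>w\<in>W. if w \<in> S v then 1 / real (card (S v)) else 0) = t v"
    proof (cases "t v = 0")
      case False
      then have v: "v \<in> supp t" by (simp add: supp_def)
      have "(\<Sum>w\<in>W. if w \<in> S v then 1 / real (card (S v)) else 0) = (\<Sum>w\<in>W \<inter> S v. 1 / real (card (S v)))"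
        using assms(2) by (rule sum.inter_restrict[symmetric])
      also have "W \<inter> S v = S v" using S[OF v] by auto
      finally show ?thesis using S[OF v] fS[OF v] by simp
    qed simp
  qed
  also have "\<dots> = 1" using assms(3) by (simp add: dists_def)
  finally have "sum (spread V S t) W = 1" .
  moreover have "0 \<le> spread V S t w" for w
    unfolding spread_def by (intro sum_nonneg pos)
  moreover have "supp (spread V S t) \<subseteq> W" using S by (auto simp: s)
  ultimately show "spread V S t \<in> dists W" by (simp add: dists_def)
qed

text \<open>Since \<open>\<psi>\<close> is injective, \<open>S v\<close> and
  \<open>S (\<phi> v)\<close> have the same cardinality and \<open>\<psi>\<close> carries one
  barycenter to the other. Vertices with \<open>t v = 0\<close> contribute nothing, which is why
  \<open>S\<close> is constrained only on \<open>supp t\<close>.\<close>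

lemma spread_affine_extension:
  assumes "finite V" "involution_on V \<phi>" "involution_on W \<psi>" "t \<in> dists V"
    and S: "\<And>v. v \<in> supp t \<Longrightarrow> S v \<subseteq> W \<and> S (\<phi> v) = \<psi> ` S v"
  shows "spread V S (affine_extension V \<phi> t) = affine_extension W \<psi> (spread V S t)"
proof
  fix w
  let ?u = "\<lambda>v w. if w \<in> S v then 1 / real (card (S v)) else 0"
  have "spread V S (affine_extension V \<phi> t) w = (\<Sum>v\<in>V. t (\<phi> v) * ?u (\<phi> (\<phi> v)) w)"
    unfolding spread_def affine_extension_involution[OF assms(2)]
    by (rule sum.cong) (use assms(2) in \<open>auto simp: involution_on_def\<close>)
  also have "\<dots> = (\<Sum>v\<in>V. t v * ?u (\<phi> v) w)"
    by (rule sum.reindex_bij_betw[OF involution_on_bij[OF assms(2)], where g = "\<lambda>v. t v * ?u (\<phi> v) w"])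
  also have "\<dots> = (\<Sum>v\<in>V. t v * (if w \<in> W then ?u v (\<psi> w) else 0))"
  proof (rule sum.cong[OF refl])
    fix v assume "v \<in> V"
    show "t v * ?u (\<phi> v) w = t v * (if w \<in> W then ?u v (\<psi> w) else 0)"
    proof (cases "t v = 0")
      case False
      then have v: "S v \<subseteq> W" "S (\<phi> v) = \<psi> ` S v" using S by (auto simp: supp_def)
      have "inj_on \<psi> (S v)"
        by (rule inj_on_subset[OF bij_betw_imp_inj_on[OF involution_on_bij[OF assms(3)]] v(1)])
      then have "card (S (\<phi> v)) = card (S v)" by (simp add: v card_image)
      moreover have "w \<in> S (\<phi> v) \<longleftrightarrow> w \<in> W \<and> \<psi> w \<in> S v"
      proof
        assume "w \<in> S (\<phi> v)"
        then obtain x where "x \<in> S v" "w = \<psi> x" using v by auto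
        then show "w \<in> W \<and> \<psi> w \<in> S v"
          using v(1) involution_onD[OF assms(3), of x] by auto
      next
        assume w: "w \<in> W \<and> \<psi> w \<in> S v"
        then have "w = \<psi> (\<psi> w)" using involution_onD(2)[OF assms(3), of w] by simp
        with w show "w \<in> S (\<phi> v)" unfolding v(2) by blast
      qed
      ultimately show ?thesis by auto
    qed simp
  qed
  also have "\<dots> = affine_extension W \<psi> (spread V S t) w"
    by (simp add: affine_extension_involution[OF assms(3)] spread_def)
  finally show "spread V S (affine_extension V \<phi> t) w = affine_extension W \<psi> (spread V S t) w" .
qed

text \<open>A continuous map from a simplex to its barycentric subdivision. It is not the inverse of the
  affine homeomorphism between them, but like that inverse it only charges the superlevel sets
  \<open>{x. t x > r}\<close> with \<open>r \<ge> 0\<close>.\<close>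

definition level_weight :: "'v set \<Rightarrow> ('v \<Rightarrow> real) \<Rightarrow> 'v set \<Rightarrow> real" where
  "level_weight V t c = (\<Prod>x\<in>c. t x * (\<Prod>y\<in>V - c. max 0 (t x - t y)))"

definition subdivide :: "'v set \<Rightarrow> ('v \<Rightarrow> real) \<Rightarrow> 'v set \<Rightarrow> real" where
  "subdivide V t = (\<lambda>c. if c \<in> Pow V - {{}}
     then level_weight V t c / (\<Sum>d\<in>Pow V - {{}}. level_weight V t d) else 0)"

lemma level_weight_nonneg: "(\<And>v. 0 \<le> t v) \<Longrightarrow> 0 \<le> level_weight V t c"
  unfolding level_weight_def by (intro prod_nonneg mult_nonneg_nonneg) auto

lemma level_weight_nonzero_iff:
  assumes "finite V" "c \<subseteq> V" "\<And>v. 0 \<le> t v"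
  shows "level_weight V t c \<noteq> 0 \<longleftrightarrow> (\<forall>x\<in>c. 0 < t x \<and> (\<forall>y\<in>V - c. t y < t x))"
proof -
  have "finite c" "finite (V - c)" using assms finite_subset by auto
  moreover have "t x \<noteq> 0 \<longleftrightarrow> 0 < t x" for x using assms(3)[of x] by auto
  moreover have "max 0 (t x - t y) \<noteq> 0 \<longleftrightarrow> t y < t x" for x y by (auto simp: max_def)
  ultimately show ?thesis
    by (simp add: level_weight_def prod_zero_iff)
qed

text \<open>The set of maximizers of \<open>t\<close> is a superlevel set and has positive weight.
  This keeps the denominator in \<open>subdivide\<close> nonzero.\<close>

lemma level_weight_sum_pos:
  assumes "finite V" "t \<in> dists V"
  shows "0 < (\<Sum>d\<in>Pow V - {{}}. level_weight V t d)"
proof -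
  have nn: "0 \<le> t v" for v using assms(2) by (simp add: dists_def)
  define m where "m = Max (t ` V)"
  define c where "c = {v \<in> V. t v = m}"
  have "supp t \<noteq> {}" "supp t \<subseteq> V" using assms(2) supp_nonempty by (auto simp: dists_def)
  then obtain v where v: "v \<in> V" "t v \<noteq> 0" by (auto simp: supp_def)
  have mge: "t x \<le> m" if "x \<in> V" for x using that assms(1) by (simp add: m_def)
  have "0 < m" using mge[OF v(1)] nn[of v] v(2) by linarith
  moreover have "m \<in> t ` V" unfolding m_def by (rule Max_in) (use v assms(1) in auto)
  ultimately have c: "c \<in> Pow V - {{}}" "\<forall>x\<in>c. 0 < t x \<and> (\<forall>y\<in>V - c. t y < t x)"
    using mge by (auto simp: c_def less_le)
  then have "0 < level_weight V t c"
    using level_weight_nonzero_iff[of V c t] level_weight_nonneg[of t V c] assms(1) nn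
    by (simp add: less_le)
  then show ?thesis
    by (intro sum_pos2[OF _ c(1)]) (simp_all add: assms(1) nn level_weight_nonneg)
qed

lemma supp_subdivide:
  assumes "finite V" "t \<in> dists V"
  shows "supp (subdivide V t) =
    {c. c \<noteq> {} \<and> c \<subseteq> V \<and> (\<forall>x\<in>c. 0 < t x \<and> (\<forall>y\<in>V - c. t y < t x))}"
proof -
  have nn: "0 \<le> t v" for v using assms(2) by (simp add: dists_def)
  have "subdivide V t c \<noteq> 0 \<longleftrightarrow> c \<in> Pow V - {{}} \<and> level_weight V t c \<noteq> 0" for c
    using level_weight_sum_pos[OF assms] by (simp add: subdivide_def)
  moreover have "level_weight V t c \<noteq> 0 \<longleftrightarrow> (\<forall>x\<in>c. 0 < t x \<and> (\<forall>y\<in>V - c. t y < t x))"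
    if "c \<subseteq> V" for c
    by (rule level_weight_nonzero_iff[OF assms(1) that nn])
  ultimately show ?thesis unfolding supp_def
    by (intro Collect_cong) (simp, meson)
qed

lemma subdivide_dists:
  assumes "finite V" "t \<in> dists V"
  shows "subdivide V t \<in> dists (Pow V - {{}})"
proof -
  let ?T = "\<Sum>d\<in>Pow V - {{}}. level_weight V t d"
  have nn: "0 \<le> t v" for v using assms(2) by (simp add: dists_def)
  have "0 \<le> subdivide V t c" for c
    using level_weight_nonneg[of t V, OF nn] level_weight_sum_pos[OF assms] by (simp add: subdivide_def)
  moreover have "supp (subdivide V t) \<subseteq> Pow V - {{}}"
    using supp_subdivide[OF assms] by auto
  moreover have "sum (subdivide V t) (Pow V - {{}}) = (\<Sum>c\<in>Pow V - {{}}. level_weight V t c / ?T)"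
    by (rule sum.cong) (simp_all only: subdivide_def if_True)
  then have "sum (subdivide V t) (Pow V - {{}}) = 1"
    using level_weight_sum_pos[OF assms] by (simp only: sum_divide_distrib[symmetric]) simp
  ultimately show ?thesis unfolding dists_def by blast
qed

text \<open>Superlevel sets of one function are nested: \<open>x \<in> c - d\<close> and
  \<open>y \<in> d - c\<close> would force both \<open>t y < t x\<close> and
  \<open>t x < t y\<close>. So each point lands in a simplex of the barycentric subdivision of the
  face \<open>supp t\<close>.\<close>

lemma subdivide_flag:
  assumes "finite V" "t \<in> dists V"
  shows "chain_subset (supp (subdivide V t))" "c \<in> supp (subdivide V t) \<Longrightarrow> c \<noteq> {} \<and> c \<subseteq> supp t"
    "finite (supp (subdivide V t))" "supp (subdivide V t) \<noteq> {}"
proof -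
  show "chain_subset (supp (subdivide V t))"
    unfolding chain_subset_def
  proof (intro ballI, rule ccontr)
    fix c d
    assume cd: "c \<in> supp (subdivide V t)" "d \<in> supp (subdivide V t)" and "\<not> (c \<subseteq> d \<or> d \<subseteq> c)"
    then obtain x y where "x \<in> c - d" "y \<in> d - c" by blast
    moreover from this have "y \<in> V - c" "x \<in> V - d"
      using cd unfolding supp_subdivide[OF assms] by auto
    ultimately have "t y < t x" "t x < t y"
      using cd unfolding supp_subdivide[OF assms] by simp_all
    then show False by simp
  qed
  show "c \<in> supp (subdivide V t) \<Longrightarrow> c \<noteq> {} \<and> c \<subseteq> supp t"
 unfolding supp_subdivide[OF assms] by (auto simp: supp_def[of t])
  have "supp (subdivide V t) \<subseteq> Pow V" unfolding supp_subdivide[OF assms] by auto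
  then show "finite (supp (subdivide V t))" using assms(1) finite_subset by blast
  show "supp (subdivide V t) \<noteq> {}" using supp_nonempty[OF subdivide_dists[OF assms]] .
qed

lemma continuous_on_subdivide:
  assumes "finite V" shows "continuous_on (dists V) (subdivide V)"
proof -
  have "continuous_on (dists V) (\<lambda>t. level_weight V t c)" for c
    unfolding level_weight_def
    by (intro continuous_on_prod continuous_on_mult continuous_on_max continuous_on_diff
        continuous_on_const continuous_on_coordinate)
  then have "continuous_on (dists V)
      (\<lambda>t. level_weight V t c / (\<Sum>d\<in>Pow V - {{}}. level_weight V t d))" for c
    using level_weight_sum_pos[OF assms]
    by (intro continuous_on_divide continuous_on_sum ballI) (simp_all add: less_imp_neq[symmetric])
  then have "continuous_on (dists V) (\<lambda>t. subdivide V t c)" for c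
    unfolding subdivide_def by (cases "c \<in> Pow V - {{}}") (simp_all only: if_True if_False continuous_on_const)
  then show ?thesis by (rule continuous_on_coordinatewise_then_product)
qed

text \<open>Level weights are built from the coordinates without regard to the names of the
  vertices, so relabelling by \<open>\<phi>\<close> permutes them and leaves their total
  unchanged.\<close>

lemma subdivide_affine_extension:
  assumes "finite V" "involution_on V \<phi>"
  shows "subdivide V (affine_extension V \<phi> t) =
    affine_extension (Pow V - {{}}) (image \<phi>) (subdivide V t)"
proof -
  have inv': "involution_on (Pow V - {{}}) (image \<phi>)" using involution_on_image[OF assms(2)] .
  have lw: "level_weight V (affine_extension V \<phi> t) c = level_weight V t (\<phi> ` c)" if "c \<subseteq> V" for c
  proof -
    have inj: "inj_on \<phi> V" using bij_betw_imp_inj_on[OF involution_on_bij[OF assms(2)]] .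
    have img: "\<phi> ` V = V" using bij_betw_imp_surj_on[OF involution_on_bij[OF assms(2)]] .
    have "V - \<phi> ` c = \<phi> ` (V - c)"
      using inj_on_image_set_diff[OF inj, of V c] that img by auto
    then have "level_weight V t (\<phi> ` c) = (\<Prod>x\<in>c. t (\<phi> x) * (\<Prod>y\<in>V - c. max 0 (t (\<phi> x) - t (\<phi> y))))"
      unfolding level_weight_def
      using inj_on_subset[OF inj that] inj_on_subset[OF inj Diff_subset]
      by (simp add: prod.reindex)
    also have "\<dots> = level_weight V (affine_extension V \<phi> t) c"
      unfolding level_weight_def affine_extension_involution[OF assms(2)]
      using that by (intro prod.cong refl) (auto intro!: prod.cong)
    finally show ?thesis by simp
  qed
  have "(\<Sum>d\<in>Pow V - {{}}. level_weight V (affine_extension V \<phi> t) d) =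
        (\<Sum>d\<in>Pow V - {{}}. level_weight V t (\<phi> ` d))"
    by (rule sum.cong) (auto simp: lw)
  also have "\<dots> = (\<Sum>d\<in>Pow V - {{}}. level_weight V t d)"
    by (rule sum.reindex_bij_betw[OF involution_on_bij[OF inv']])
  finally have tot: "(\<Sum>d\<in>Pow V - {{}}. level_weight V (affine_extension V \<phi> t) d) =
        (\<Sum>d\<in>Pow V - {{}}. level_weight V t d)" .
  show ?thesis
  proof
    fix c
    show "subdivide V (affine_extension V \<phi> t) c =
      affine_extension (Pow V - {{}}) (image \<phi>) (subdivide V t) c"
    proof (cases "c \<in> Pow V - {{}}")
      case True
      moreover have "\<phi> ` c \<in> Pow V - {{}}" using involution_onD(1)[OF inv' True] .
      ultimately show ?thesis
        unfolding affine_extension_involution[OF inv'] subdivide_def tot by (simp add: lw)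
    next
      case False
      then show ?thesis
        unfolding affine_extension_involution[OF inv'] subdivide_def by (simp only: if_False)
    qed
  qed
qed


section \<open>Finite chains of sets\<close>

lemma chain_Union_mem:
  assumes "chain_subset F" "finite F" "F \<noteq> {}" shows "\<Union>F \<in> F"
  using Union_in_chain[OF assms(2,3)] assms(1) by (simp add: chain_subset_alt_def)

lemma chain_Inter_mem:
  assumes "chain_subset F" "finite F" "F \<noteq> {}" shows "\<Inter>F \<in> F"
  using Inter_in_chain[OF assms(2,3)] assms(1) by (simp add: chain_subset_alt_def)

lemma chain_subset_mono: "chain_subset G \<Longrightarrow> F \<subseteq> G \<Longrightarrow> chain_subset F"
  by (auto simp: chain_subset_def)

text \<open>Images do not commute with intersections in general; here they do because the
  intersection is itself a member of the chain.\<close>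

lemma image_chain_Inter:
  assumes "chain_subset F" "finite F" "F \<noteq> {}"
  shows "\<Inter>(image \<phi> ` F) = \<phi> ` \<Inter>F"
proof
  show "\<Inter>(image \<phi> ` F) \<subseteq> \<phi> ` \<Inter>F"
    using chain_Inter_mem[OF assms] by (rule INF_lower)
  show "\<phi> ` \<Inter>F \<subseteq> \<Inter>(image \<phi> ` F)" by auto
qed

lemma image_Union_image: "\<Union>(image \<phi> ` F) = \<phi> ` \<Union>F"
  by auto

text \<open>If the sets \<open>S v\<close> form a chain, a coordinate of \<open>spread V S t\<close>
  grows with the collection of members containing the vertex. Its nonempty superlevel sets are
  therefore members of the chain, and subdividing again creates no new sets.\<close>

lemma supp_subdivide_spread:
  assumes "finite V" "finite W" "t \<in> dists V"
    and S: "\<And>v. v \<in> supp t \<Longrightarrow> S v \<noteq> {} \<and> S v \<subseteq> W"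
    and chain: "chain_subset (S ` supp t)"
  shows "supp (subdivide W (spread V S t)) \<subseteq> S ` supp t"
proof
  fix c assume c: "c \<in> supp (subdivide W (spread V S t))"
  let ?w = "spread V S t" and ?F = "S ` supp t"
  have w: "?w \<in> dists W" by (rule spread_dists[OF assms(1-3) S])
  have c': "c \<noteq> {}" "c \<subseteq> W" "c \<subseteq> supp ?w" "\<And>x y. x \<in> c \<Longrightarrow> y \<in> W - c \<Longrightarrow> ?w y < ?w x"
    using c supp_subdivide[OF assms(2) w] subdivide_flag(2)[OF assms(2) w c] by auto
  have "supp t \<subseteq> V" using assms(3) by (simp add: dists_def)
  then have finF: "finite ?F" by (rule finite_imageI[OF finite_subset[OF _ assms(1)]])
  let ?D = "{s \<in> ?F. \<not> c \<subseteq> s}"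
  \<comment> \<open>The members that fail to contain \<open>c\<close> have a largest one, which is
    their union. Hence some \<open>x \<in> c\<close> avoids all of them and lies only in members
    that contain \<open>c\<close>.\<close>
  have "\<not> c \<subseteq> \<Union>?D"
  proof (cases "?D = {}")
    case True
    then show ?thesis using c'(1) by (simp only: True Union_empty) auto
  next
    case False
    have "\<Union>?D \<in> ?D"
      by (rule chain_Union_mem[OF chain_subset_mono[OF chain] _ False]) (use finF in auto)
    then show ?thesis by simp
  qed
  then obtain x where x: "x \<in> c" "\<And>s. s \<in> ?F \<Longrightarrow> x \<in> s \<Longrightarrow> c \<subseteq> s" by blast
  let ?E = "{s \<in> ?F. x \<in> s}"
  have "x \<in> supp ?w" using x c' by blast
  then have "?E \<noteq> {}" using supp_spread[OF assms(1-3), of S] S by auto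
  then have E: "\<Inter>?E \<in> ?E"
    by (intro chain_Inter_mem chain_subset_mono[OF chain]) (use finF in auto)
  \<comment> \<open>Such a \<open>y\<close> lies in every charged set that contains
    \<open>x\<close>, so it receives at least the mass of \<open>x\<close> and cannot fall outside
    the superlevel set \<open>c\<close>.\<close>
  have "y \<in> c" if y: "y \<in> \<Inter>?E" for y
  proof (rule ccontr)
    assume "y \<notin> c"
    moreover have "y \<in> W" using y E S by blast
    ultimately have "?w y < ?w x" using c'(4)[OF x(1)] by blast
    moreover have "?w x \<le> ?w y" unfolding spread_def
    proof (rule sum_mono)
      fix v
      have "t v = 0 \<or> (x \<in> S v \<longrightarrow> y \<in> S v)" using y by (auto simp: supp_def)
      moreover have "0 \<le> t v" using assms(3) by (simp add: dists_def)
      ultimately show "t v * (if x \<in> S v then 1 / real (card (S v)) else 0)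
          \<le> t v * (if y \<in> S v then 1 / real (card (S v)) else 0)" by auto
    qed
    ultimately show False by simp
  qed
  moreover have "c \<subseteq> \<Inter>?E" using x by blast
  ultimately have "c = \<Inter>?E" by blast
  then show "c \<in> ?F" using E by simp
qed

text \<open>This produces all equivariant maps below: \<open>\<beta>\<close> will be a single or
  threefold subdivision, and \<open>S\<close> assigns vertices of the target complex to each new
  vertex. \<open>S\<close> has to behave well only on vertices charged by points of the complex, not
  of the whole simplex.\<close>

lemma z2_map_spread:
  fixes \<beta> :: "('v \<Rightarrow> real) \<Rightarrow> 'u \<Rightarrow> real" and S :: "'u \<Rightarrow> 'w set"
  assumes "finite V" "K \<subseteq> Pow V" "finite V'" "finite W" "K' \<subseteq> Pow W"
    and "involution_on V' \<phi>'" "involution_on W \<psi>"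
    and \<beta>: "continuous_on (dists V) \<beta>" "\<And>t. t \<in> dists V \<Longrightarrow> \<beta> t \<in> dists V'"
      "\<And>t. t \<in> dists V \<Longrightarrow> \<beta> (affine_extension V \<phi> t) = affine_extension V' \<phi>' (\<beta> t)"
    and S: "\<And>t u. t \<in> dists V \<Longrightarrow> supp t \<in> K \<Longrightarrow> u \<in> supp (\<beta> t) \<Longrightarrow> S u \<noteq> {} \<and> S (\<phi>' u) = \<psi> ` S u"
    and SK: "\<And>t. t \<in> dists V \<Longrightarrow> supp t \<in> K \<Longrightarrow> (\<Union>u\<in>supp (\<beta> t). S u) \<in> K'"
  shows "z2_map (realization K, affine_extension V \<phi>) (realization K', affine_extension W \<psi>)
    (spread V' S \<circ> \<beta>)"
proof -
  have SW: "S u \<subseteq> W" if "t \<in> dists V" "supp t \<in> K" "u \<in> supp (\<beta> t)" for t u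
    using SK[OF that(1,2)] assms(5) that(3) by auto
  have "spread V' S (\<beta> t) \<in> dists W \<and> supp (spread V' S (\<beta> t)) \<in> K'"
    if "t \<in> dists V" "supp t \<in> K" for t
    using spread_dists[OF assms(3,4) \<beta>(2)[OF that(1)], of S]
      supp_spread[OF assms(3,4) \<beta>(2)[OF that(1)], of S] SW[OF that] S[OF that] SK[OF that]
    by simp
  moreover have "spread V' S (\<beta> (affine_extension V \<phi> t)) = affine_extension W \<psi> (spread V' S (\<beta> t))"
    if "t \<in> dists V" "supp t \<in> K" for t
    unfolding \<beta>(3)[OF that(1)]
    using spread_affine_extension[OF assms(3,6,7) \<beta>(2)[OF that(1)], of S] SW[OF that] S[OF that]
    by simp
  moreover have "continuous_on {t \<in> dists V. supp t \<in> K} (spread V' S \<circ> \<beta>)"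
    by (rule continuous_on_compose[OF continuous_on_subset[OF \<beta>(1)] continuous_on_spread]) auto
  ultimately show ?thesis
    unfolding z2_map_def fst_conv realization_eq[OF assms(1,2)] realization_eq[OF assms(4,5)]
    by (auto simp: equivariant_def)
qed

lemma z2_map_comp:
  assumes "z2_map X Y f" "z2_map Y Z g" shows "z2_map X Z (g \<circ> f)"
  using assms unfolding z2_map_def equivariant_def
  by (auto simp: continuous_map_compose dest: continuous_map_image_subset_topspace)

lemma z2_map_id: "is_z2_space X \<Longrightarrow> z2_map X X id"
  by (simp add: z2_map_def equivariant_def)

section \<open>Threefold subdivision\<close>

abbreviation subsets :: "'a set \<Rightarrow> 'a set set" where
  "subsets V \<equiv> Pow V - {{}}"

definition subdivide3 :: "'v set \<Rightarrow> ('v \<Rightarrow> real) \<Rightarrow> 'v set set set \<Rightarrow> real" where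
  "subdivide3 V t = subdivide (subsets (subsets V)) (subdivide (subsets V) (subdivide V t))"

lemma
  assumes "finite V"
  shows continuous_on_subdivide3: "continuous_on (dists V) (subdivide3 V)"
    and subdivide3_dists: "t \<in> dists V \<Longrightarrow> subdivide3 V t \<in> dists (subsets (subsets (subsets V)))"
    and subdivide3_affine_extension: "involution_on V \<phi> \<Longrightarrow> t \<in> dists V \<Longrightarrow>
      subdivide3 V (affine_extension V \<phi> t) =
        affine_extension (subsets (subsets (subsets V))) (image (image (image \<phi>))) (subdivide3 V t)"
proof -
  have fin: "finite (subsets V)" "finite (subsets (subsets V))" using assms by auto
  have into: "subdivide V t \<in> dists (subsets V)"
    "subdivide (subsets V) (subdivide V t) \<in> dists (subsets (subsets V))" if "t \<in> dists V" for t
    using subdivide_dists[OF assms that] subdivide_dists[OF fin(1) subdivide_dists[OF assms that]]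
    by simp_all
  have "continuous_on (dists V) (\<lambda>t. subdivide (subsets V) (subdivide V t))"
    by (rule continuous_on_compose2[OF continuous_on_subdivide[OF fin(1)] continuous_on_subdivide[OF assms]])
      (use into in auto)
  then show "continuous_on (dists V) (subdivide3 V)"
    unfolding subdivide3_def
    by (rule continuous_on_compose2[OF continuous_on_subdivide[OF fin(2)]]) (use into in auto)
  show "t \<in> dists V \<Longrightarrow> subdivide3 V t \<in> dists (subsets (subsets (subsets V)))"
    unfolding subdivide3_def by (rule subdivide_dists[OF fin(2) into(2)])
  show "subdivide3 V (affine_extension V \<phi> t) =
        affine_extension (subsets (subsets (subsets V))) (image (image (image \<phi>))) (subdivide3 V t)"
    if "involution_on V \<phi>" "t \<in> dists V"
    unfolding subdivide3_def
    by (simp only: subdivide_affine_extension assms fin that involution_on_image)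
qed

text \<open>A vertex \<open>\<Omega>\<close> of the third subdivision is a flag of flags of simplices. From it one reads off
  simplices \<open>lowest \<Omega> \<subseteq> lower \<Omega> \<subseteq> upper \<Omega> \<subseteq> highest \<Omega>\<close>, the outer two from the largest flag and
  the inner two from the smallest, so that the inequalities persist between different vertices
  of one simplex.\<close>

definition "lowest \<Omega> = \<Inter>(\<Union>\<Omega>)"
definition "lower \<Omega> = \<Inter>(\<Inter>\<Omega>)"
definition "upper \<Omega> = \<Union>(\<Inter>\<Omega>)"
definition "highest \<Omega> = \<Union>(\<Union>\<Omega>)"

text \<open>A vertex of the third subdivision is a finite chain of finite chains, so all these
  intersections and unions are attained by members, and intersections commute with images. Two
  vertices of one simplex are nested: enlarging \<open>\<Omega>\<close> shrinks
  \<open>\<Inter>\<Omega>\<close>, hence raises \<open>lower\<close> and reduces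
  \<open>upper\<close>, while \<open>\<Inter>\<Omega> \<subseteq> \<Union>\<Omega>'\<close> holds
  either way and gives the outer inclusions.\<close>

lemma
  assumes "finite V" "t \<in> dists V" and \<Omega>: "\<Omega> \<in> supp (subdivide3 V t)"
  shows subdivide3_simplices:
      "lowest \<Omega> \<in> supp (subdivide V t)" "lower \<Omega> \<in> supp (subdivide V t)"
      "upper \<Omega> \<in> supp (subdivide V t)" "highest \<Omega> \<in> supp (subdivide V t)" "lower \<Omega> \<subseteq> upper \<Omega>"
    and subdivide3_image:
      "lowest (image (image \<phi>) ` \<Omega>) = \<phi> ` lowest \<Omega>" "lower (image (image \<phi>) ` \<Omega>) = \<phi> ` lower \<Omega>"
      "upper (image (image \<phi>) ` \<Omega>) = \<phi> ` upper \<Omega>" "highest (image (image \<phi>) ` \<Omega>) = \<phi> ` highest \<Omega>"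
    and subdivide3_nested: "\<Omega>' \<in> supp (subdivide3 V t) \<Longrightarrow> lowest \<Omega>' \<subseteq> lower \<Omega>"
      "\<Omega>' \<in> supp (subdivide3 V t) \<Longrightarrow> upper \<Omega> \<subseteq> highest \<Omega>'"
      "\<Omega>' \<in> supp (subdivide3 V t) \<Longrightarrow>
        lower \<Omega> \<subseteq> lower \<Omega>' \<and> upper \<Omega>' \<subseteq> upper \<Omega> \<or> lower \<Omega>' \<subseteq> lower \<Omega> \<and> upper \<Omega> \<subseteq> upper \<Omega>'"
proof -
  let ?T1 = "supp (subdivide V t)" and ?T2 = "supp (subdivide (subsets V) (subdivide V t))"
  have fin: "finite (subsets V)" "finite (subsets (subsets V))" using assms(1) by auto
  have d1: "subdivide V t \<in> dists (subsets V)" by (rule subdivide_dists[OF assms(1,2)])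
  have d2: "subdivide (subsets V) (subdivide V t) \<in> dists (subsets (subsets V))"
    by (rule subdivide_dists[OF fin(1) d1])
  note f1 = subdivide_flag[OF assms(1,2)]
  note f2 = subdivide_flag[OF fin(1) d1]
  note f3 = subdivide_flag[OF fin(2) d2, folded subdivide3_def]
  have fl3: "chain_subset \<Omega> \<and> finite \<Omega> \<and> \<Omega> \<noteq> {}"
    using f3(2)[OF \<Omega>] chain_subset_mono[OF f2(1), of \<Omega>] finite_subset[OF _ f2(3), of \<Omega>] by simp
  then have mem: "\<Inter>\<Omega> \<in> \<Omega>" "\<Union>\<Omega> \<in> \<Omega>" by (simp_all add: chain_Inter_mem chain_Union_mem)
  have fl2: "chain_subset s \<and> finite s \<and> s \<noteq> {}" "s \<subseteq> ?T1" if "s \<in> \<Omega>" for s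
  proof -
    have "s \<in> ?T2" using f3(2)[OF \<Omega>] that by blast
    then show "chain_subset s \<and> finite s \<and> s \<noteq> {}" "s \<subseteq> ?T1"
      using f2(2) chain_subset_mono[OF f1(1), of s] finite_subset[OF _ f1(3), of s] by simp_all
  qed
  have mem': "\<Inter>s \<in> s" "\<Union>s \<in> s" if "s \<in> \<Omega>" for s
    using fl2(1)[OF that] by (simp_all add: chain_Inter_mem chain_Union_mem)
  show "lowest \<Omega> \<in> ?T1" "lower \<Omega> \<in> ?T1" "upper \<Omega> \<in> ?T1" "highest \<Omega> \<in> ?T1"
    unfolding lowest_def lower_def upper_def highest_def
    using mem'[OF mem(1)] mem'[OF mem(2)] fl2(2)[OF mem(1)] fl2(2)[OF mem(2)] by blast+
  show "lower \<Omega> \<subseteq> upper \<Omega>"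
    unfolding lower_def upper_def using mem'[OF mem(1)] by blast
  have im: "\<Inter>(image (image \<phi>) ` \<Omega>) = image \<phi> ` \<Inter>\<Omega>" "\<Inter>(image \<phi> ` s) = \<phi> ` \<Inter>s" if "s \<in> \<Omega>" for s
    using image_chain_Inter[of \<Omega> "image \<phi>"] image_chain_Inter[of s \<phi>] fl3 fl2(1)[OF that] by simp_all
  show "lowest (image (image \<phi>) ` \<Omega>) = \<phi> ` lowest \<Omega>" "lower (image (image \<phi>) ` \<Omega>) = \<phi> ` lower \<Omega>"
      "upper (image (image \<phi>) ` \<Omega>) = \<phi> ` upper \<Omega>" "highest (image (image \<phi>) ` \<Omega>) = \<phi> ` highest \<Omega>"
    unfolding lowest_def lower_def upper_def highest_def
    by (simp_all only: im(1)[OF mem(1)] im(2)[OF mem(1)] im(2)[OF mem(2)] image_Union_image)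
  assume \<Omega>': "\<Omega>' \<in> supp (subdivide3 V t)"
  have cmp: "\<Omega> \<subseteq> \<Omega>' \<or> \<Omega>' \<subseteq> \<Omega>" using f3(1) \<Omega> \<Omega>' by (auto simp: chain_subset_def)
  moreover have "\<Omega>' \<noteq> {}" using f3(2)[OF \<Omega>'] by blast
  ultimately have "\<Inter>\<Omega> \<subseteq> \<Union>\<Omega>'" using fl3 by blast
  then show "lowest \<Omega>' \<subseteq> lower \<Omega>" "upper \<Omega> \<subseteq> highest \<Omega>'"
    unfolding lowest_def lower_def upper_def highest_def by blast+
  from cmp have "\<Inter>\<Omega>' \<subseteq> \<Inter>\<Omega> \<or> \<Inter>\<Omega> \<subseteq> \<Inter>\<Omega>'" by blast
  then show "lower \<Omega> \<subseteq> lower \<Omega>' \<and> upper \<Omega>' \<subseteq> upper \<Omega> \<or> lower \<Omega>' \<subseteq> lower \<Omega> \<and> upper \<Omega> \<subseteq> upper \<Omega>'"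
    unfolding lower_def upper_def by (meson Inter_anti_mono Union_mono)
qed


section \<open>Flags of closed sets and cliques\<close>

definition common :: "'a set \<Rightarrow> ('a \<Rightarrow> 'a \<Rightarrow> bool) \<Rightarrow> 'a set \<Rightarrow> 'a set" where
  "common X R A = {v \<in> X. \<forall>a\<in>A. R a v}"

definition closed_sets :: "'a set \<Rightarrow> ('a \<Rightarrow> 'a \<Rightarrow> bool) \<Rightarrow> 'a set set" where
  "closed_sets X R = {A. A \<noteq> {} \<and> A \<subseteq> X \<and> common X R A \<noteq> {} \<and> common X R (common X R A) = A}"

text \<open>This collects what the homotopy argument needs from comparability. Only
  \<open>core_nonempty\<close> rests on the lattice property; the rest holds in any finite poset
  with a monotone involution.\<close>

locale involutive_graph =
  fixes X :: "'a set" and R :: "'a \<Rightarrow> 'a \<Rightarrow> bool" and C :: "'a \<Rightarrow> 'a"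
  assumes finite_X: "finite X"
    and sym: "x \<in> X \<Longrightarrow> y \<in> X \<Longrightarrow> R x y \<Longrightarrow> R y x"
    and invol: "involution_on X C"
    and R_C: "x \<in> X \<Longrightarrow> y \<in> X \<Longrightarrow> R x y \<Longrightarrow> R (C x) (C y)"
    and core_nonempty: "A \<in> closed_sets X R \<Longrightarrow> A \<inter> common X R A \<noteq> {}"
begin

abbreviation "N \<equiv> common X R"
abbreviation "Q \<equiv> closed_sets X R"
abbreviation "star A \<equiv> C ` N A"

text \<open>The condition \<open>s \<subseteq> N s\<close> includes \<open>R x x\<close> for every
  member, just as the comparability condition in \<open>chains\<close> does.\<close>

definition cliques :: "'a set set" where
  "cliques = {s. s \<noteq> {} \<and> s \<subseteq> X \<and> s \<subseteq> N s}"

definition flags :: "'a set set set" where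
  "flags = {F. F \<noteq> {} \<and> F \<subseteq> Q \<and> chain_subset F}"

definition core :: "'a set set \<Rightarrow> 'a set" where
  "core F = (\<Union>A\<in>F. A \<inter> N A)"

definition span :: "'a set \<Rightarrow> 'a set set" where
  "span s = {N (N s), N s}"

definition ends :: "'a set set \<Rightarrow> 'a set set" where
  "ends b = {\<Inter>b, \<Union>b}"

text \<open>For \<open>a \<subseteq> b\<close>, the two members form an interval contained both in the one bounded by
  \<open>ends b\<close> and in the one bounded by \<open>span (core a)\<close>.\<close>

definition middle :: "'a set set \<Rightarrow> 'a set set \<Rightarrow> 'a set set" where
  "middle a b = {N (N (\<Inter>b \<union> core a)), \<Union>b \<inter> N (core a)}"

section \<open>The Galois connection of common neighbours\<close>

lemma N_subset: "N A \<subseteq> X"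
  by (auto simp: common_def)

lemma N_antimono: "A \<subseteq> B \<Longrightarrow> N B \<subseteq> N A"
  by (auto simp: common_def)

lemma N_N_extensive: "A \<subseteq> X \<Longrightarrow> A \<subseteq> N (N A)"
  using sym by (auto simp: common_def)

lemma N_N_N: "A \<subseteq> X \<Longrightarrow> N (N (N A)) = N A"
  by (rule equalityI[OF N_antimono[OF N_N_extensive] N_N_extensive[OF N_subset]])

lemma N_swap: "A \<subseteq> X \<Longrightarrow> B \<subseteq> N A \<Longrightarrow> A \<subseteq> N B"
  by (rule order_trans[OF N_N_extensive N_antimono])

lemma N_Un: "N (A \<union> B) = N A \<inter> N B"
  by (auto simp: common_def)

lemma C_C: "A \<subseteq> X \<Longrightarrow> C ` C ` A = A"
  using involution_onD(2)[OF invol] by (force simp: image_image)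

lemma C_subset: "A \<subseteq> X \<Longrightarrow> C ` A \<subseteq> X"
  using involution_onD(1)[OF invol] by blast

lemma inj_C: "inj_on C X"
  by (rule bij_betw_imp_inj_on[OF involution_on_bij[OF invol]])

lemma N_C_subset: "A \<subseteq> X \<Longrightarrow> C ` N A \<subseteq> N (C ` A)"
  using R_C involution_onD(1)[OF invol] by (auto simp: common_def subset_iff)

text \<open>The remaining inclusion is \<open>N_C_subset\<close> for the image of \<open>A\<close>,
  transported back by \<open>C\<close>.\<close>

lemma N_C: assumes "A \<subseteq> X" shows "N (C ` A) = C ` N A"
proof
  have "C ` N (C ` A) \<subseteq> N (C ` C ` A)" by (rule N_C_subset[OF C_subset[OF assms]])
  then have "C ` C ` N (C ` A) \<subseteq> C ` N A" by (metis C_C assms image_mono)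
  then show "N (C ` A) \<subseteq> C ` N A" by (simp add: C_C N_subset)
qed (rule N_C_subset[OF assms])

lemma QD:
  assumes "A \<in> Q" shows "A \<noteq> {}" "A \<subseteq> X" "N A \<noteq> {}" "N (N A) = A"
  using assms by (auto simp: closed_sets_def)

lemma finite_Q: "finite Q"
  by (rule finite_subset[of _ "Pow X"]) (auto simp: closed_sets_def finite_X)

lemma N_mem_Q: "s \<subseteq> X \<Longrightarrow> s \<noteq> {} \<Longrightarrow> N s \<noteq> {} \<Longrightarrow> N s \<in> Q"
  using N_N_extensive[of s] by (auto simp: closed_sets_def N_N_N N_subset)

lemma N_N_mem_Q:
  assumes "s \<subseteq> X" "s \<noteq> {}" "N s \<noteq> {}" shows "N (N s) \<in> Q"
  using N_mem_Q[OF N_subset assms(3)] N_N_extensive[OF assms(1)] assms(2) by blast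

text \<open>\<open>N\<close> commutes with \<open>C\<close>, so applying \<open>star\<close> twice
  amounts to \<open>N (N A)\<close>, which is \<open>A\<close> for closed sets.\<close>

lemma star_involution: "involution_on Q star"
proof -
  have "C ` N A \<in> Q" if "A \<in> Q" for A
    using QD[OF that] unfolding closed_sets_def
    by (auto simp: N_C N_subset C_subset)
  then show ?thesis
    unfolding involution_on_def by (simp add: N_C N_subset C_C QD)
qed

lemma cliqueD: assumes "s \<in> cliques" shows "s \<noteq> {}" "s \<subseteq> X" "s \<subseteq> N s" "N (N s) \<subseteq> N s"
  using assms N_antimono[of s "N s"] by (auto simp: cliques_def)

lemma clique_subset:
  assumes "s \<in> cliques" "s' \<subseteq> s" "s' \<noteq> {}" shows "s' \<in> cliques"
  using cliqueD[OF assms(1)] assms(2,3) N_antimono[OF assms(2)] by (auto simp: cliques_def)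

text \<open>\<open>N (N s) \<subseteq> N s\<close> for a clique, and \<open>N s\<close> is also the
  set of common neighbours of \<open>N (N s)\<close>.\<close>

lemma clique_closure:
  assumes "s \<in> cliques" shows "N (N s) \<in> cliques"
  using cliqueD[OF assms] N_N_extensive[of s] by (auto simp: cliques_def N_N_N N_subset)

lemma clique_C: "s \<in> cliques \<Longrightarrow> C ` s \<in> cliques"
  by (auto simp: cliques_def N_C dest: involution_onD(1)[OF invol] intro!: imageI)

lemma flagD: assumes "F \<in> flags" shows "F \<noteq> {}" "F \<subseteq> Q" "chain_subset F" "finite F"
  using assms finite_subset[OF _ finite_Q] by (auto simp: flags_def)

lemma flag_subset: "F \<in> flags \<Longrightarrow> F' \<subseteq> F \<Longrightarrow> F' \<noteq> {} \<Longrightarrow> F' \<in> flags"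
  unfolding flags_def using chain_subset_mono[of F F'] by auto

lemma flag_star: assumes "F \<in> flags" shows "star ` F \<in> flags"
proof -
  have "chain_subset (star ` F)"
    unfolding chain_subset_def
  proof (intro ballI)
    fix A' B' assume "A' \<in> star ` F" "B' \<in> star ` F"
    then obtain A B where "A \<in> F" "B \<in> F" "A' = star A" "B' = star B" by blast
    moreover from this have "N A \<subseteq> N B \<or> N B \<subseteq> N A"
      using flagD(3)[OF assms] N_antimono unfolding chain_subset_def by meson
    ultimately show "A' \<subseteq> B' \<or> B' \<subseteq> A'" by (auto intro: image_mono)
  qed
  then show ?thesis
    using flagD[OF assms] involution_onD(1)[OF star_involution] by (auto simp: flags_def)
qed

lemma flag_Inter: "F \<in> flags \<Longrightarrow> \<Inter>F \<in> F" and flag_Union: "F \<in> flags \<Longrightarrow> \<Union>F \<in> F"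
  by (rule chain_Inter_mem chain_Union_mem; simp add: flagD)+

lemma core_mono: "a \<subseteq> b \<Longrightarrow> core a \<subseteq> core b"
  by (auto simp: core_def)

text \<open>For \<open>A \<subseteq> B\<close> in a flag, every element of \<open>A \<inter> N A\<close> lies in \<open>B\<close>, hence is adjacent to all
  of \<open>B \<inter> N B\<close>.\<close>

lemma core_clique: assumes "F \<in> flags" shows "core F \<in> cliques"
proof -
  obtain A where A: "A \<in> F" using flagD(1)[OF assms] by auto
  then have "A \<inter> N A \<noteq> {}" using core_nonempty flagD(2)[OF assms] by blast
  then have "core F \<noteq> {}" using A by (auto simp: core_def)
  moreover have "core F \<subseteq> X" by (auto simp: core_def common_def)
  moreover have "y \<in> N (core F)" if y: "y \<in> core F" for y
  proof -
    have "R x y" if x: "x \<in> core F" for x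
    proof -
      obtain A where A: "A \<in> F" "x \<in> A" "x \<in> N A" using x by (auto simp: core_def)
      obtain B where B: "B \<in> F" "y \<in> B" "y \<in> N B" using y by (auto simp: core_def)
      consider "A \<subseteq> B" | "B \<subseteq> A" using A B flagD(3)[OF assms] by (auto simp: chain_subset_def)
      then show ?thesis
      proof cases
        case 1
        then show ?thesis using A B by (auto simp: common_def)
      next
        case 2
        then show ?thesis using A B sym by (auto simp: common_def)
      qed
    qed
    then show ?thesis using y by (auto simp: common_def core_def)
  qed
  ultimately show ?thesis by (auto simp: cliques_def)
qed

text \<open>For closed \<open>A\<close> the set \<open>A \<inter> N A\<close> is unchanged when
  \<open>A\<close> and \<open>N A\<close> trade places, so only the factor \<open>C\<close> of
  \<open>star\<close> is felt.\<close>

lemma core_star: assumes "F \<subseteq> Q" shows "core (star ` F) = C ` core F"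
proof -
  have "C ` N A \<inter> N (C ` N A) = C ` (A \<inter> N A)" if "A \<in> F" for A
  proof -
    have A: "A \<in> Q" using that assms by blast
    have "C ` N A \<inter> N (C ` N A) = C ` N A \<inter> C ` A" by (simp add: N_C N_subset QD[OF A])
    also have "\<dots> = C ` (A \<inter> N A)"
      using inj_on_image_Int[OF inj_C N_subset QD(2)[OF A]] by (simp add: Int_commute)
    finally show ?thesis .
  qed
  then show ?thesis unfolding core_def by (auto simp: image_UN)
qed

lemma span_subset_Q: "s \<in> cliques \<Longrightarrow> span s \<subseteq> Q"
  using cliqueD[of s] N_mem_Q[of s] N_N_mem_Q[of s] by (auto simp: span_def)

lemma span_star: "s \<subseteq> X \<Longrightarrow> span (C ` s) = star ` span s"
  by (auto simp: span_def N_C N_N_N N_subset)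

text \<open>As a clique \<open>s\<close> grows, the interval from \<open>N (N s)\<close> to
  \<open>N s\<close> shrinks at both ends. Intervals of a chain of cliques are thus nested, and all
  their ends are comparable.\<close>

lemma spans_flag:
  assumes "F \<noteq> {}" "F \<subseteq> cliques" "chain_subset F" shows "(\<Union>s\<in>F. span s) \<in> flags"
proof -
  have "chain_subset (\<Union>s\<in>F. span s)"
    unfolding chain_subset_def
  proof (intro ballI)
    fix A B assume "A \<in> (\<Union>s\<in>F. span s)" "B \<in> (\<Union>s\<in>F. span s)"
    then obtain s r where sr: "s \<in> F" "A \<in> span s" "r \<in> F" "B \<in> span r" by blast
    have c: "N (N s) \<subseteq> N s" "N (N r) \<subseteq> N r" using cliqueD(4) sr assms(2) by blast+
    have "s \<subseteq> r \<or> r \<subseteq> s" using sr assms(3) by (auto simp: chain_subset_def)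
    then have "N r \<subseteq> N s \<and> N (N s) \<subseteq> N (N r) \<or> N s \<subseteq> N r \<and> N (N r) \<subseteq> N (N s)"
      using N_antimono by meson
    then show "A \<subseteq> B \<or> B \<subseteq> A" using c sr(2,4) unfolding span_def by auto
  qed
  moreover have "(\<Union>s\<in>F. span s) \<subseteq> Q" using span_subset_Q assms(2) by blast
  moreover have "(\<Union>s\<in>F. span s) \<noteq> {}" using assms(1) by (auto simp: span_def)
  ultimately show ?thesis by (simp add: flags_def)
qed

text \<open>\<open>star\<close> reverses inclusion, so it exchanges the smallest and the largest
  member of a flag.\<close>

lemma Inter_star: assumes "b \<in> flags" shows "\<Inter>(star ` b) = star (\<Union>b)" "\<Union>(star ` b) = star (\<Inter>b)"
proof -
  have "star (\<Union>b) \<subseteq> star A" "star A \<subseteq> star (\<Inter>b)" if "A \<in> b" for A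
    using that by (intro image_mono N_antimono; auto)+
  then show "\<Inter>(star ` b) = star (\<Union>b)" "\<Union>(star ` b) = star (\<Inter>b)"
    by (intro equalityI INF_lower[OF flag_Union[OF assms]] INF_greatest
        SUP_upper[OF flag_Inter[OF assms]] SUP_least; simp)+
qed

lemma ends_star: "b \<in> flags \<Longrightarrow> ends (star ` b) = star ` ends b"
  by (auto simp: ends_def Inter_star)

lemma ends_subset: "b \<in> flags \<Longrightarrow> ends b \<subseteq> b"
  by (simp add: ends_def flag_Inter flag_Union)

text \<open>Every \<open>A \<in> a\<close> satisfies
  \<open>\<Inter>b \<subseteq> A \<subseteq> \<Union>b\<close>. Hence \<open>core a\<close> lies in
  \<open>\<Union>b\<close> and in \<open>N (\<Inter>b)\<close>, and the latter means
  \<open>\<Inter>b \<subseteq> N (core a)\<close>. So the lower candidate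
  \<open>\<Inter>b \<union> core a\<close> is contained in the closed upper one, and so is its
  closure.\<close>

lemma
  assumes a: "a \<in> flags" and b: "b \<in> flags" and ab: "a \<subseteq> b"
  shows middle_subset_Q: "middle a b \<subseteq> Q"
    and middle_le: "N (N (\<Inter>b \<union> core a)) \<subseteq> \<Union>b \<inter> N (core a)"
    and middle_ends: "\<Inter>b \<subseteq> N (N (\<Inter>b \<union> core a))"
    and middle_span: "N (N (core a)) \<subseteq> N (N (\<Inter>b \<union> core a))"
    and middle_star: "middle (star ` a) (star ` b) = star ` middle a b"
proof -
  let ?M = "\<Inter>b \<union> core a" and ?T = "\<Union>b \<inter> N (core a)"
  have Ib: "\<Inter>b \<in> Q" "\<Union>b \<in> Q" using subsetD[OF flagD(2)[OF b]] flag_Inter[OF b] flag_Union[OF b] by simp_all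
  note Ib' = QD[OF Ib(1)] QD[OF Ib(2)]
  note ca = cliqueD[OF core_clique[OF a]]
  have M: "?M \<subseteq> X" "?M \<noteq> {}" using Ib'(1,2) ca(2) by auto
  have "\<Inter>b \<subseteq> A" if "A \<in> a" for A using that ab by blast
  then have "A \<inter> N A \<subseteq> N (\<Inter>b)" if "A \<in> a" for A
    using that by (intro le_infI2 N_antimono)
  then have "core a \<subseteq> N (\<Inter>b)" unfolding core_def by (rule UN_least)
  then have 1: "\<Inter>b \<subseteq> N (core a)" by (rule N_swap[OF Ib'(2)])
  have 2: "\<Inter>b \<subseteq> \<Union>b" by (rule Union_upper[OF flag_Inter[OF b]])
  have 3: "core a \<subseteq> \<Union>b" using ab by (auto simp: core_def)
  \<comment> \<open>An intersection of closed sets is closed: with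
    \<open>\<Union>b = N (N (\<Union>b))\<close>, \<open>?T\<close> is the common neighbourhood of a
    union.\<close>
  have T: "N (N ?T) = ?T"
  proof -
    have "?T = N (N (\<Union>b) \<union> core a)" by (simp add: N_Un Ib')
    then show ?thesis using N_N_N[of "N (\<Union>b) \<union> core a"] ca(2) N_subset by simp
  qed
  have "?M \<subseteq> ?T" using 1 2 3 ca(3) by simp
  then have "N (N ?M) \<subseteq> N (N ?T)" by (intro N_antimono)
  then show le: "N (N ?M) \<subseteq> ?T" by (simp only: T)
  have MT: "?M \<subseteq> N (N ?M)" by (rule N_N_extensive[OF M(1)])
  then show "\<Inter>b \<subseteq> N (N ?M)" by simp
  show "N (N (core a)) \<subseteq> N (N ?M)" by (intro N_antimono) simp
  have "N ?T \<noteq> {}" using Ib'(7) N_antimono[of ?T "\<Union>b"] by auto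
  moreover have "?T \<noteq> {}" using M(2) \<open>?M \<subseteq> ?T\<close> by (metis subset_empty)
  ultimately have TQ: "?T \<in> Q" using T Ib'(6) by (auto simp: closed_sets_def)
  have "N ?M \<noteq> {}" using N_antimono[OF \<open>?M \<subseteq> ?T\<close>] \<open>N ?T \<noteq> {}\<close> by auto
  then have MQ: "N (N ?M) \<in> Q" by (rule N_N_mem_Q[OF M])
  show "middle a b \<subseteq> Q" using TQ MQ by (simp add: middle_def)
  \<comment> \<open>For equivariance, \<open>star\<close> must turn the lower member into the upper
    member for the image flags (\<open>e1\<close>) and the upper into the lower
    (\<open>e2\<close>).\<close>
  have "star (N (N ?M)) = C ` (N (\<Inter>b) \<inter> N (core a))"
    by (simp only: N_N_N[OF M(1)]) (simp only: N_Un)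
  then have sM: "star (N (N ?M)) = star (\<Inter>b) \<inter> C ` N (core a)"
    by (simp only: inj_on_image_Int[OF inj_C N_subset N_subset])
  have cs: "core (star ` a) = C ` core a" by (rule core_star[OF flagD(2)[OF a]])
  have e1: "\<Union>(star ` b) \<inter> N (core (star ` a)) = star (N (N ?M))"
    unfolding sM cs Inter_star[OF b] by (simp add: N_C ca(2))
  have "N ?T = N (N (N (\<Union>b) \<union> core a))" by (simp add: N_Un Ib')
  then have "star ?T = N (N (C ` (N (\<Union>b) \<union> core a)))"
    using ca(2) N_subset by (simp add: N_C)
  then have e2: "N (N (\<Inter>(star ` b) \<union> core (star ` a))) = star ?T"
    unfolding cs Inter_star[OF b] by (simp add: image_Un)
  show "middle (star ` a) (star ` b) = star ` middle a b"
    unfolding middle_def e1 e2 by auto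
qed

text \<open>Between vertices of one simplex of the third subdivision, \<open>lower\<close> grows
  exactly when \<open>upper\<close> shrinks. With this monotonicity their middle intervals are
  nested.\<close>

lemma middle_anti:
  assumes "a \<subseteq> a'" "b' \<subseteq> b"
  shows "N (N (\<Inter>b \<union> core a)) \<subseteq> N (N (\<Inter>b' \<union> core a'))" "\<Union>b' \<inter> N (core a') \<subseteq> \<Union>b \<inter> N (core a)"
  by (intro N_antimono Un_mono Inter_anti_mono core_mono Int_mono Union_mono assms)+

lemma cliques_Pow: "cliques \<subseteq> Pow X" and flags_Pow: "flags \<subseteq> Pow Q"
  by (auto simp: cliques_def flags_def)

section \<open>The maps between flags and cliques, and the homotopies\<close>

definition "to_clique = spread (subsets Q) core \<circ> subdivide Q"
definition "to_flag = spread (subsets X) span \<circ> subdivide X"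
text \<open>Template for the intermediate self-maps of the flag complex: \<open>S\<close> picks the
  ends of an interval of closed sets for each vertex of the third subdivision.\<close>

definition "bend S = spread (subsets (subsets (subsets Q))) S \<circ> subdivide3 Q"

abbreviation "flag_space \<equiv> (realization flags, affine_extension Q star)"
abbreviation "clique_space \<equiv> (realization cliques, affine_extension X C)"

lemma flag_level:
  assumes "t \<in> dists Q" "supp t \<in> flags"
  shows "s \<in> supp (subdivide Q t) \<Longrightarrow> s \<in> flags \<and> s \<subseteq> supp t"
    "core ` supp (subdivide Q t) \<subseteq> cliques" "chain_subset (core ` supp (subdivide Q t))"
proof -
  show *: "s \<in> flags \<and> s \<subseteq> supp t" if "s \<in> supp (subdivide Q t)" for s
    using subdivide_flag(2)[OF finite_Q assms(1) that] flag_subset[OF assms(2)] by simp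
  then show "core ` supp (subdivide Q t) \<subseteq> cliques" by (intro image_subsetI core_clique) simp
  show "chain_subset (core ` supp (subdivide Q t))"
    using subdivide_flag(1)[OF finite_Q assms(1)] unfolding chain_subset_def
    by (simp, meson core_mono)
qed

lemma clique_level:
  assumes "t \<in> dists X" "supp t \<in> cliques"
  shows "s \<in> supp (subdivide X t) \<Longrightarrow> s \<in> cliques \<and> s \<subseteq> supp t"
  using subdivide_flag(2)[OF finite_X assms(1), of s] clique_subset[OF assms(2)] by simp

lemma core_levels:
  assumes "t \<in> dists Q" "supp t \<in> flags"
  shows "(\<Union>s\<in>supp (subdivide Q t). core s) \<in> cliques"
    "(\<Union>s\<in>supp (subdivide Q t). core s) \<subseteq> core (supp t)"
proof -
  obtain s where s: "s \<in> supp (subdivide Q t)"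
    using subdivide_flag(4)[OF finite_Q assms(1)] by auto
  have "core s \<noteq> {}" using cliqueD(1)[OF core_clique, of s] flag_level(1)[OF assms s] by simp
  moreover show "(\<Union>s\<in>supp (subdivide Q t). core s) \<subseteq> core (supp t)"
    by (intro UN_least core_mono) (simp add: flag_level(1)[OF assms])
  ultimately show "(\<Union>s\<in>supp (subdivide Q t). core s) \<in> cliques"
    using s by (intro clique_subset[OF core_clique[OF assms(2)]]) auto
qed

lemma to_clique_map: "z2_map flag_space clique_space to_clique"
  unfolding to_clique_def
proof (rule z2_map_spread[OF finite_Q flags_Pow _ finite_X cliques_Pow
      involution_on_image[OF star_involution] invol continuous_on_subdivide[OF finite_Q]
      subdivide_dists[OF finite_Q] subdivide_affine_extension[OF finite_Q star_involution]])
  show "finite (subsets Q)" using finite_Q by simp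
  fix t assume t: "t \<in> dists Q" "supp t \<in> flags"
  show "core s \<noteq> {} \<and> core (star ` s) = C ` core s" if "s \<in> supp (subdivide Q t)" for s
    using flag_level(1)[OF t that] cliqueD(1)[OF core_clique, of s] core_star[of s] flagD(2)[of s] by simp
  show "(\<Union>s\<in>supp (subdivide Q t). core s) \<in> cliques" by (rule core_levels[OF t])
qed

lemma to_flag_map: "z2_map clique_space flag_space to_flag"
  unfolding to_flag_def
proof (rule z2_map_spread[OF finite_X cliques_Pow _ finite_Q flags_Pow
      involution_on_image[OF invol] star_involution continuous_on_subdivide[OF finite_X]
      subdivide_dists[OF finite_X] subdivide_affine_extension[OF finite_X invol]])
  show "finite (subsets X)" using finite_X by simp
  fix t assume t: "t \<in> dists X" "supp t \<in> cliques"
  show "span s \<noteq> {} \<and> span (C ` s) = star ` span s" if "s \<in> supp (subdivide X t)" for s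
    using span_star[of s] clique_level[OF t that] cliqueD(2)[of s] by (simp add: span_def)
  show "(\<Union>s\<in>supp (subdivide X t). span s) \<in> flags"
    by (intro spans_flag subsetI) (simp_all add: clique_level[OF t] subdivide_flag[OF finite_X t(1)])
qed

lemma supp_to_clique:
  assumes "t \<in> dists Q" "supp t \<in> flags"
  shows "supp (to_clique t) = (\<Union>s\<in>supp (subdivide Q t). core s)" "to_clique t \<in> dists X"
proof -
  have "core s \<noteq> {} \<and> core s \<subseteq> X" if "s \<in> supp (subdivide Q t)" for s
    using flag_level(1)[OF assms that] cliqueD(1,2)[OF core_clique, of s] by simp
  then show "supp (to_clique t) = (\<Union>s\<in>supp (subdivide Q t). core s)" "to_clique t \<in> dists X"
    unfolding to_clique_def comp_def
    using supp_spread[OF _ finite_X subdivide_dists[OF finite_Q assms(1)], of core]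
      spread_dists[OF _ finite_X subdivide_dists[OF finite_Q assms(1)], of core] finite_Q by simp_all
qed

lemma supp_to_flag:
  assumes "t \<in> dists X" "supp t \<in> cliques"
  shows "supp (to_flag t) = (\<Union>s\<in>supp (subdivide X t). span s)" "to_flag t \<in> dists Q"
proof -
  have "span s \<noteq> {} \<and> span s \<subseteq> Q" if "s \<in> supp (subdivide X t)" for s
    using clique_level[OF assms that] span_subset_Q[of s] by (auto simp: span_def)
  then show "supp (to_flag t) = (\<Union>s\<in>supp (subdivide X t). span s)" "to_flag t \<in> dists Q"
    unfolding to_flag_def comp_def
    using supp_spread[OF _ finite_Q subdivide_dists[OF finite_X assms(1)], of span]
      spread_dists[OF _ finite_Q subdivide_dists[OF finite_X assms(1)], of span] finite_X by simp_all
qed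

lemma clique_space: "is_z2_space clique_space"
  by (rule is_z2_space_realization[OF finite_X cliques_Pow invol clique_C])

lemma flag_space: "is_z2_space flag_space"
  by (rule is_z2_space_realization[OF finite_Q flags_Pow star_involution flag_star])

text \<open>Everything stays in one simplex: for a face \<open>s\<close> of \<open>supp t\<close>,
  \<open>core (span s) \<subseteq> N (N s) \<subseteq> N (N (supp t))\<close>, and this last set is
  a clique containing \<open>supp t\<close>.\<close>

lemma clique_homotopy: "z2_homotopic clique_space clique_space (to_clique \<circ> to_flag) id"
proof -
  have "supp ((to_clique \<circ> to_flag) t) \<union> supp (id t) \<in> cliques"
    if t: "t \<in> dists X" "supp t \<in> cliques" for t
  proof -
    note c = cliqueD[OF t(2)]
    note st = supp_to_flag[OF t]
    have fl: "supp (to_flag t) \<in> flags"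
      unfolding st(1)
      by (intro spans_flag subsetI) (simp_all add: clique_level[OF t] subdivide_flag[OF finite_X t(1)])
    have "supp (to_clique (to_flag t)) \<subseteq> core (supp (to_flag t))"
      using core_levels(2)[OF st(2) fl] supp_to_clique(1)[OF st(2) fl] by simp
    also have "\<dots> = (\<Union>s\<in>supp (subdivide X t). core (span s))"
      unfolding st(1) by (auto simp: core_def)
    also have "\<dots> \<subseteq> N (N (supp t))"
    proof (rule UN_least)
      fix s assume s: "s \<in> supp (subdivide X t)"
      note s' = clique_level[OF t s]
      have "core (span s) \<subseteq> N (N s)" by (auto simp: core_def span_def)
      also have "\<dots> \<subseteq> N (N (supp t))" using s' by (intro N_antimono) simp
      finally show "core (span s) \<subseteq> N (N (supp t))" .
    qed
    finally have "supp (to_clique (to_flag t)) \<union> supp t \<subseteq> N (N (supp t))"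
      using N_N_extensive[OF c(2)] by simp
    then show ?thesis
      using c(1) by (intro clique_subset[OF clique_closure[OF t(2)]]) simp_all
  qed
  then show ?thesis
    by (intro z2_homotopic_straight_line[OF finite_X cliques_Pow clique_subset,
          where S = "{t \<in> dists X. supp t \<in> cliques}"]
        z2_map_comp[OF to_flag_map to_clique_map] z2_map_id clique_space)
      (simp_all add: realization_eq[OF finite_X cliques_Pow])
qed

lemma flag_straight_line:
  assumes "z2_map flag_space flag_space f" "z2_map flag_space flag_space g"
    and "\<And>t. t \<in> dists Q \<Longrightarrow> supp t \<in> flags \<Longrightarrow> supp (f t) \<union> supp (g t) \<in> flags"
  shows "z2_homotopic flag_space flag_space f g"
  by (rule z2_homotopic_straight_line[OF finite_Q flags_Pow flag_subset _ assms(1,2),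
        where S = "{t \<in> dists Q. supp t \<in> flags}"])
    (simp_all add: realization_eq[OF finite_Q flags_Pow] assms(3))

lemma
  assumes "\<And>t \<Omega>. t \<in> dists Q \<Longrightarrow> supp t \<in> flags \<Longrightarrow> \<Omega> \<in> supp (subdivide3 Q t) \<Longrightarrow>
      S \<Omega> \<noteq> {} \<and> S (image (image star) ` \<Omega>) = star ` S \<Omega>"
    and "\<And>t. t \<in> dists Q \<Longrightarrow> supp t \<in> flags \<Longrightarrow> (\<Union>\<Omega>\<in>supp (subdivide3 Q t). S \<Omega>) \<in> flags"
  shows bend_map: "z2_map flag_space flag_space (bend S)"
    and supp_bend: "t \<in> dists Q \<Longrightarrow> supp t \<in> flags \<Longrightarrow>
      supp (bend S t) = (\<Union>\<Omega>\<in>supp (subdivide3 Q t). S \<Omega>)"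
proof -
  have fin: "finite (subsets (subsets (subsets Q)))" using finite_Q by simp
  show "z2_map flag_space flag_space (bend S)"
    unfolding bend_def
    by (rule z2_map_spread[OF finite_Q flags_Pow fin finite_Q flags_Pow
      involution_on_image[OF involution_on_image[OF involution_on_image[OF star_involution]]]
      star_involution continuous_on_subdivide3[OF finite_Q] subdivide3_dists[OF finite_Q]
      subdivide3_affine_extension[OF finite_Q star_involution] assms])
  assume t: "t \<in> dists Q" "supp t \<in> flags"
  have "S \<Omega> \<noteq> {} \<and> S \<Omega> \<subseteq> Q" if "\<Omega> \<in> supp (subdivide3 Q t)" for \<Omega>
    using assms(1)[OF t that] flagD(2)[OF assms(2)[OF t]] that by blast
  then show "supp (bend S t) = (\<Union>\<Omega>\<in>supp (subdivide3 Q t). S \<Omega>)"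
    unfolding bend_def comp_def
    by (rule supp_spread[OF fin finite_Q subdivide3_dists[OF finite_Q t(1)]])
qed

text \<open>The path from the composite to the identity runs through \<open>bend S3\<close>,
  \<open>bend S2\<close> and \<open>bend S1\<close>. Consecutive maps have supports inside one flag
  at every point, so four straight lines suffice; \<open>S2\<close> mediates between intervals
  spanned by cores and intervals bounded by the given flags.\<close>

lemma flag_homotopy: "z2_homotopic flag_space flag_space (to_flag \<circ> to_clique) id"
proof -
  \<comment> \<open>For vertices of one simplex \<open>lowest \<Omega>' \<subseteq> lower \<Omega>
    \<subseteq> upper \<Omega> \<subseteq> highest \<Omega>'\<close>. This choice places the
    interval \<open>S2 \<Omega>\<close> inside both \<open>S1 \<Omega>'\<close> and
    \<open>S3 \<Omega>'\<close>, even for different vertices.\<close>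
  define S1 where "S1 \<Omega> = ends (highest \<Omega>)" for \<Omega>
  define S2 where "S2 \<Omega> = middle (lower \<Omega>) (upper \<Omega>)" for \<Omega>
  define S3 where "S3 \<Omega> = span (core (lowest \<Omega>))" for \<Omega>
  \<comment> \<open>A flag that will contain the supports at \<open>t\<close> of both the composite
    and \<open>bend S3\<close>.\<close>
  define level where "level t = (\<Union>s\<in>core ` supp (subdivide Q t). span s)" for t
  let ?I = "\<lambda>t. supp (subdivide3 Q t)"
  have fl: "lowest \<Omega> \<in> flags" "lower \<Omega> \<in> flags" "upper \<Omega> \<in> flags" "highest \<Omega> \<in> flags"
    "highest \<Omega> \<subseteq> supp t"
    if "t \<in> dists Q" "supp t \<in> flags" "\<Omega> \<in> ?I t" for t \<Omega>
    using subdivide3_simplices[OF finite_Q that(1,3)] flag_level(1)[OF that(1,2)] by blast+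
  have eq: "S1 \<Omega> \<noteq> {} \<and> S1 (image (image star) ` \<Omega>) = star ` S1 \<Omega>"
    "S2 \<Omega> \<noteq> {} \<and> S2 (image (image star) ` \<Omega>) = star ` S2 \<Omega>"
    "S3 \<Omega> \<noteq> {} \<and> S3 (image (image star) ` \<Omega>) = star ` S3 \<Omega>"
    if "t \<in> dists Q" "supp t \<in> flags" "\<Omega> \<in> ?I t" for t \<Omega>
  proof -
    note f = fl[OF that] and im = subdivide3_image[OF finite_Q that(1,3), of star]
    show "S1 \<Omega> \<noteq> {} \<and> S1 (image (image star) ` \<Omega>) = star ` S1 \<Omega>"
      unfolding S1_def im ends_star[OF f(4)] by (simp add: ends_def)
    show "S2 \<Omega> \<noteq> {} \<and> S2 (image (image star) ` \<Omega>) = star ` S2 \<Omega>"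
      unfolding S2_def im middle_star[OF f(2,3) subdivide3_simplices(5)[OF finite_Q that(1,3)]]
      by (simp add: middle_def)
    show "S3 \<Omega> \<noteq> {} \<and> S3 (image (image star) ` \<Omega>) = star ` S3 \<Omega>"
      unfolding S3_def im core_star[OF flagD(2)[OF f(1)]] span_star[OF cliqueD(2)[OF core_clique[OF f(1)]]]
      by (simp add: span_def)
  qed
  have lev: "level t \<in> flags" if "t \<in> dists Q" "supp t \<in> flags" for t
    unfolding level_def
    by (intro spans_flag flag_level(2,3)[OF that])
      (simp add: subdivide_flag(4)[OF finite_Q that(1)])
  have U1: "(\<Union>\<Omega>\<in>?I t. S1 \<Omega>) \<subseteq> supp t" if "t \<in> dists Q" "supp t \<in> flags" for t
    using fl[OF that] ends_subset unfolding S1_def by blast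
  have U3: "(\<Union>\<Omega>\<in>?I t. S3 \<Omega>) \<subseteq> level t" if "t \<in> dists Q" "supp t \<in> flags" for t
    using subdivide3_simplices(1)[OF finite_Q that(1)] unfolding S3_def level_def by blast
  have U2: "(\<Union>\<Omega>\<in>?I t. S1 \<Omega>) \<union> (\<Union>\<Omega>\<in>?I t. S2 \<Omega>) \<in> flags"
    "(\<Union>\<Omega>\<in>?I t. S2 \<Omega>) \<union> (\<Union>\<Omega>\<in>?I t. S3 \<Omega>) \<in> flags"
    if t: "t \<in> dists Q" "supp t \<in> flags" for t
  proof -
    define M where "M \<Omega> = N (N (\<Inter>(upper \<Omega>) \<union> core (lower \<Omega>)))" for \<Omega>
    define T where "T \<Omega> = \<Union>(upper \<Omega>) \<inter> N (core (lower \<Omega>))" for \<Omega>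
    have S2: "S2 \<Omega> = {M \<Omega>, T \<Omega>}" for \<Omega> by (simp add: S2_def M_def T_def middle_def)
    note ab = fl(2)[OF t] fl(3)[OF t] subdivide3_simplices(5)[OF finite_Q t(1)]
    have ne: "?I t \<noteq> {}" by (rule supp_nonempty[OF subdivide3_dists[OF finite_Q t(1)]])
    have MT: "M \<Omega> \<subseteq> T \<Omega>" if "\<Omega> \<in> ?I t" for \<Omega>
      unfolding M_def T_def by (rule middle_le[OF ab(1)[OF that] ab(2)[OF that] ab(3)[OF that]])
    have S2Q: "S2 \<Omega> \<subseteq> Q" if "\<Omega> \<in> ?I t" for \<Omega>
      unfolding S2_def by (rule middle_subset_Q[OF ab(1)[OF that] ab(2)[OF that] ab(3)[OF that]])
    have c22: "M \<Omega> \<subseteq> M \<Omega>' \<and> T \<Omega>' \<subseteq> T \<Omega> \<or> M \<Omega>' \<subseteq> M \<Omega> \<and> T \<Omega> \<subseteq> T \<Omega>'"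
      if "\<Omega> \<in> ?I t" "\<Omega>' \<in> ?I t" for \<Omega> \<Omega>'
      using subdivide3_nested(3)[OF finite_Q t(1) that] unfolding M_def T_def
      by (meson middle_anti)
    have c12: "\<Inter>(highest \<Omega>') \<subseteq> M \<Omega> \<and> T \<Omega> \<subseteq> \<Union>(highest \<Omega>')"
      if "\<Omega> \<in> ?I t" "\<Omega>' \<in> ?I t" for \<Omega> \<Omega>'
      using subdivide3_nested(2)[OF finite_Q t(1) that] middle_ends[OF ab(1)[OF that(1)] ab(2)[OF that(1)] ab(3)[OF that(1)]]
      unfolding M_def T_def by blast
    have c32: "N (N (core (lowest \<Omega>'))) \<subseteq> M \<Omega> \<and> T \<Omega> \<subseteq> N (core (lowest \<Omega>'))"
      if "\<Omega> \<in> ?I t" "\<Omega>' \<in> ?I t" for \<Omega> \<Omega>'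
    proof -
      have "N (core (lower \<Omega>)) \<subseteq> N (core (lowest \<Omega>'))"
        by (intro N_antimono core_mono subdivide3_nested(1)[OF finite_Q t(1) that])
      then show ?thesis
        using middle_span[OF ab(1)[OF that(1)] ab(2)[OF that(1)] ab(3)[OF that(1)]] N_antimono
        unfolding M_def T_def by blast
    qed
    have ch2: "A \<subseteq> B \<or> B \<subseteq> A" if "\<Omega> \<in> ?I t" "\<Omega>' \<in> ?I t" "A \<in> S2 \<Omega>" "B \<in> S2 \<Omega>'" for A B \<Omega> \<Omega>'
      using c22[OF that(1,2)] MT[OF that(1)] MT[OF that(2)] that(3,4) unfolding S2 by auto
    have ch12: "A \<subseteq> B \<or> B \<subseteq> A" if "\<Omega> \<in> ?I t" "\<Omega>' \<in> ?I t" "A \<in> S2 \<Omega>" "B \<in> S1 \<Omega>'" for A B \<Omega> \<Omega>'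
      using c12[OF that(1,2)] MT[OF that(1)] that(3,4) unfolding S2 S1_def ends_def by auto
    have ch32: "A \<subseteq> B \<or> B \<subseteq> A" if "\<Omega> \<in> ?I t" "\<Omega>' \<in> ?I t" "A \<in> S2 \<Omega>" "B \<in> S3 \<Omega>'" for A B \<Omega> \<Omega>'
      using c32[OF that(1,2)] MT[OF that(1)] that(3,4) unfolding S2 S3_def span_def by auto
    have ch1: "A \<subseteq> B \<or> B \<subseteq> A" if "\<Omega> \<in> ?I t" "\<Omega>' \<in> ?I t" "A \<in> S1 \<Omega>" "B \<in> S1 \<Omega>'" for A B \<Omega> \<Omega>'
      using U1[OF t] flagD(3)[OF t(2)] that unfolding chain_subset_def by blast
    have ch3: "A \<subseteq> B \<or> B \<subseteq> A" if "\<Omega> \<in> ?I t" "\<Omega>' \<in> ?I t" "A \<in> S3 \<Omega>" "B \<in> S3 \<Omega>'" for A B \<Omega> \<Omega>'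
      using U3[OF t] flagD(3)[OF lev[OF t]] that unfolding chain_subset_def by blast
    have "(\<Union>\<Omega>\<in>?I t. S1 \<Omega>) \<subseteq> Q" "(\<Union>\<Omega>\<in>?I t. S3 \<Omega>) \<subseteq> Q"
      using order_trans[OF U1[OF t] flagD(2)[OF t(2)]] order_trans[OF U3[OF t] flagD(2)[OF lev[OF t]]]
      by simp_all
    moreover have "(\<Union>\<Omega>\<in>?I t. S2 \<Omega>) \<subseteq> Q" by (rule UN_least) (rule S2Q)
    moreover have "(\<Union>\<Omega>\<in>?I t. S2 \<Omega>) \<noteq> {}" using ne by (auto simp: S2)
    moreover have "chain_subset ((\<Union>\<Omega>\<in>?I t. S1 \<Omega>) \<union> (\<Union>\<Omega>\<in>?I t. S2 \<Omega>))"
      unfolding chain_subset_def using ch1 ch2 ch12 by (elim UnE UN_E | intro ballI)+ meson+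
    moreover have "chain_subset ((\<Union>\<Omega>\<in>?I t. S2 \<Omega>) \<union> (\<Union>\<Omega>\<in>?I t. S3 \<Omega>))"
      unfolding chain_subset_def using ch2 ch3 ch32 by (elim UnE UN_E | intro ballI)+ meson+
    ultimately show "(\<Union>\<Omega>\<in>?I t. S1 \<Omega>) \<union> (\<Union>\<Omega>\<in>?I t. S2 \<Omega>) \<in> flags"
      "(\<Union>\<Omega>\<in>?I t. S2 \<Omega>) \<union> (\<Union>\<Omega>\<in>?I t. S3 \<Omega>) \<in> flags"
      by (simp_all add: flags_def)
  qed
  have nonempty: "(\<Union>\<Omega>\<in>?I t. S1 \<Omega>) \<noteq> {}" "(\<Union>\<Omega>\<in>?I t. S2 \<Omega>) \<noteq> {}" "(\<Union>\<Omega>\<in>?I t. S3 \<Omega>) \<noteq> {}"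
    if t: "t \<in> dists Q" for t
    using supp_nonempty[OF subdivide3_dists[OF finite_Q t]]
    by (auto simp: S1_def S2_def S3_def ends_def middle_def span_def)
  have u1: "(\<Union>\<Omega>\<in>?I t. S1 \<Omega>) \<in> flags" if "t \<in> dists Q" "supp t \<in> flags" for t
    by (rule flag_subset[OF U2(1)[OF that] _ nonempty(1)[OF that(1)]]) simp
  have u2: "(\<Union>\<Omega>\<in>?I t. S2 \<Omega>) \<in> flags" if "t \<in> dists Q" "supp t \<in> flags" for t
    by (rule flag_subset[OF U2(1)[OF that] _ nonempty(2)[OF that(1)]]) simp
  have u3: "(\<Union>\<Omega>\<in>?I t. S3 \<Omega>) \<in> flags" if "t \<in> dists Q" "supp t \<in> flags" for t
    by (rule flag_subset[OF U2(2)[OF that] _ nonempty(3)[OF that(1)]]) simp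
  have map1: "z2_map flag_space flag_space (bend S1)"
    by (rule bend_map, erule (2) eq(1), erule (1) u1)
  have supp1: "supp (bend S1 t) = (\<Union>\<Omega>\<in>?I t. S1 \<Omega>)" if "t \<in> dists Q" "supp t \<in> flags" for t
    by (rule supp_bend[OF _ _ that], erule (2) eq(1), erule (1) u1)
  have map2: "z2_map flag_space flag_space (bend S2)"
    by (rule bend_map, erule (2) eq(2), erule (1) u2)
  have supp2: "supp (bend S2 t) = (\<Union>\<Omega>\<in>?I t. S2 \<Omega>)" if "t \<in> dists Q" "supp t \<in> flags" for t
    by (rule supp_bend[OF _ _ that], erule (2) eq(2), erule (1) u2)
  have map3: "z2_map flag_space flag_space (bend S3)"
    by (rule bend_map, erule (2) eq(3), erule (1) u3)
  have supp3: "supp (bend S3 t) = (\<Union>\<Omega>\<in>?I t. S3 \<Omega>)" if "t \<in> dists Q" "supp t \<in> flags" for t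
    by (rule supp_bend[OF _ _ that], erule (2) eq(3), erule (1) u3)
  have comp: "supp (to_flag (to_clique t)) \<subseteq> level t" if t: "t \<in> dists Q" "supp t \<in> flags" for t
  proof -
    have cl: "to_clique t \<in> dists X" "supp (to_clique t) \<in> cliques"
      using supp_to_clique[OF t] core_levels(1)[OF t] by simp_all
    have "core s \<noteq> {} \<and> core s \<subseteq> X" if "s \<in> supp (subdivide Q t)" for s
      using flag_level(1)[OF t that] cliqueD(1,2)[OF core_clique, of s] by simp
    \<comment> \<open>The cores form a chain, so subdividing \<open>to_clique t\<close> charges only
      cores and no other subsets; hence only spans of cores occur in the composite.\<close>
    then have "supp (subdivide X (to_clique t)) \<subseteq> core ` supp (subdivide Q t)"
      unfolding to_clique_def comp_def
      using finite_Q flag_level(3)[OF t]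
      by (intro supp_subdivide_spread[OF _ finite_X subdivide_dists[OF finite_Q t(1)]]) auto
    then show ?thesis unfolding supp_to_flag(1)[OF cl] level_def by blast
  qed
  have "z2_homotopic flag_space flag_space (to_flag \<circ> to_clique) (bend S3)"
  proof (rule flag_straight_line[OF z2_map_comp[OF to_clique_map to_flag_map] map3])
    fix t assume t: "t \<in> dists Q" "supp t \<in> flags"
    have "supp (bend S3 t) \<subseteq> level t" "supp (bend S3 t) \<noteq> {}"
      using supp3[OF t] U3[OF t] nonempty(3)[OF t(1)] by simp_all
    then show "supp ((to_flag \<circ> to_clique) t) \<union> supp (bend S3 t) \<in> flags"
      using comp[OF t] by (intro flag_subset[OF lev[OF t]]) simp_all
  qed
  moreover have "z2_homotopic flag_space flag_space (bend S3) (bend S2)"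
    by (rule flag_straight_line[OF map3 map2]) (simp add: supp2 supp3 U2(2) Un_commute)
  moreover have "z2_homotopic flag_space flag_space (bend S2) (bend S1)"
    by (rule flag_straight_line[OF map2 map1]) (simp add: supp1 supp2 U2(1) Un_commute)
  moreover have "z2_homotopic flag_space flag_space (bend S1) id"
    by (rule flag_straight_line[OF map1 z2_map_id[OF flag_space]])
      (simp add: supp1 U1 Un_absorb1)
  ultimately show ?thesis
    unfolding z2_homotopic_def by (meson homotopic_with_trans)
qed

theorem flag_clique_equivalence: "z2_homotopy_equivalent flag_space clique_space"
  unfolding z2_homotopy_equivalent_def
  using flag_space clique_space to_clique_map to_flag_map flag_homotopy clique_homotopy by blast

end


section \<open>Comparability in a semilattice\<close>

text \<open>The infimum is taken in the lattice with added bounds. The lower bound \<open>m\<close>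
  keeps it from being \<open>Hat0\<close>, and any element of \<open>B\<close> keeps it from being
  \<open>Hat1\<close>.\<close>

lemma hat_greatest_lower_bound:
  assumes "finite_semilattice L" "B \<subseteq> carrier L" "B \<noteq> {}" "m \<in> carrier L"
    and "\<And>b. b \<in> B \<Longrightarrow> m \<sqsubseteq>\<^bsub>L\<^esub> b"
  obtains c where "c \<in> carrier L" "\<And>b. b \<in> B \<Longrightarrow> c \<sqsubseteq>\<^bsub>L\<^esub> b"
    "\<And>x. x \<in> carrier L \<Longrightarrow> (\<And>b. b \<in> B \<Longrightarrow> x \<sqsubseteq>\<^bsub>L\<^esub> b) \<Longrightarrow> x \<sqsubseteq>\<^bsub>L\<^esub> c"
proof -
  let ?H = "hat_poset L"
  interpret H: Lattice.lattice ?H using assms(1) by (simp add: finite_semilattice_def)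
  define i where "i = \<Sqinter>\<^bsub>?H\<^esub>(Elt ` B)"
  have H: "carrier ?H = {Hat0, Hat1} \<union> Elt ` carrier L" "le ?H = hat_le L"
    by (simp_all add: hat_poset_def)
  have "finite B" using finite_subset[OF assms(2)] assms(1) by (simp add: finite_semilattice_def)
  moreover have B: "Elt ` B \<subseteq> carrier ?H" using assms(2) by (auto simp: H)
  ultimately have g: "greatest ?H i (Lower ?H (Elt ` B))"
    unfolding i_def using assms(3) by (intro H.finite_inf_greatest) simp_all
  have le: "hat_le L (Elt x) i" if "x \<in> carrier L" "\<And>b. b \<in> B \<Longrightarrow> x \<sqsubseteq>\<^bsub>L\<^esub> b" for x
  proof -
    have "Elt x \<in> Lower ?H (Elt ` B)"
      by (rule Lower_memI) (use that B in \<open>auto simp: H\<close>)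
    then show ?thesis using greatest_le[OF g] by (simp add: H)
  qed
  have c: "hat_le L i (Elt b)" if "b \<in> B" for b
    using greatest_Lower_below[OF g imageI[OF that] B] by (simp add: H)
  obtain b where "b \<in> B" using assms(3) by auto
  then have "hat_le L i (Elt b)" by (rule c)
  moreover have "hat_le L (Elt m) i" using le assms(4,5) by simp
  moreover have "i \<in> carrier ?H" by (rule greatest_closed[OF g])
  ultimately obtain c where c': "i = Elt c" "c \<in> carrier L"
    by (cases i) (auto simp: H)
  show thesis
  proof (rule that)
    show "c \<in> carrier L" by (rule c'(2))
    show "c \<sqsubseteq>\<^bsub>L\<^esub> b" if "b \<in> B" for b using c[OF that] by (simp add: c')
    show "x \<sqsubseteq>\<^bsub>L\<^esub> c" if "x \<in> carrier L" "\<And>b. b \<in> B \<Longrightarrow> x \<sqsubseteq>\<^bsub>L\<^esub> b" for x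
      using le[OF that] by (simp add: c')
  qed
qed

lemma finite_minimal_element:
  assumes "partial_order L" "finite W" "W \<noteq> {}" "W \<subseteq> carrier L"
  obtains m where "m \<in> W" "\<And>x. x \<in> W \<Longrightarrow> x \<sqsubseteq>\<^bsub>L\<^esub> m \<Longrightarrow> x = m"
proof -
  interpret partial_order L by fact
  have "\<exists>m\<in>W. \<forall>x\<in>W. x \<sqsubseteq>\<^bsub>L\<^esub> m \<longrightarrow> x = m"
    using assms(2-4)
  proof (induction rule: finite_ne_induct)
    case (insert w W)
    then obtain m where m: "m \<in> W" "\<forall>x\<in>W. x \<sqsubseteq>\<^bsub>L\<^esub> m \<longrightarrow> x = m" by auto
    show ?case
    proof (cases "w \<sqsubseteq>\<^bsub>L\<^esub> m")
      case True
      have "x = w" if "x \<in> W" "x \<sqsubseteq>\<^bsub>L\<^esub> w" for x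
      proof -
        have "x \<in> carrier L" "w \<in> carrier L" "m \<in> carrier L" using that m(1) insert.prems by auto
        then have "x \<sqsubseteq>\<^bsub>L\<^esub> m" using le_trans[OF that(2) True] by simp
        then have "x = m" using m(2) that(1) by simp
        then show ?thesis using that(2) True \<open>w \<in> carrier L\<close> \<open>x \<in> carrier L\<close> le_antisym by simp
      qed
      then show ?thesis by blast
    qed (use m in blast)
  qed auto
  then show thesis using that by blast
qed

text \<open>If \<open>m\<close> is minimal in \<open>A \<union> B\<close> and lies in \<open>A\<close>, it is below all of \<open>B\<close>, so \<open>B\<close> has an infimum
  in \<open>L\<close>. It lies in \<open>A\<close>, being a lower bound of \<open>B\<close>, and in \<open>B\<close>, since each \<open>a \<in> A\<close> is either
  a lower bound of \<open>B\<close> or above some element of \<open>B\<close>.\<close>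

lemma comparable_core_nonempty:
  assumes L: "finite_semilattice L" and A: "A \<in> closed_sets (carrier L) (comparable L)"
  shows "A \<inter> common (carrier L) (comparable L) A \<noteq> {}"
proof -
  let ?N = "common (carrier L) (comparable L)"
  interpret partial_order L using L by (simp add: finite_semilattice_def)
  \<comment> \<open>Stated for an abstract pair that is symmetric under exchange, because the
    minimal element may lie in \<open>A\<close> or in its set of common neighbours.\<close>
  have step: "A \<inter> B \<noteq> {}"
    if AB: "A = ?N B" "B = ?N A" "B \<noteq> {}" and m: "m \<in> A" "\<And>x. x \<in> A \<union> B \<Longrightarrow> x \<sqsubseteq>\<^bsub>L\<^esub> m \<Longrightarrow> x = m"
    for A B m
  proof -
    have sub: "A \<subseteq> carrier L" "B \<subseteq> carrier L"
      using AB(1,2) by (auto simp: common_def)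
    have "m \<sqsubseteq>\<^bsub>L\<^esub> b" if b: "b \<in> B" for b
    proof -
      have "comparable L m b" using b m(1) AB(2) by (auto simp: common_def)
      moreover have "b \<sqsubseteq>\<^bsub>L\<^esub> m \<Longrightarrow> m \<sqsubseteq>\<^bsub>L\<^esub> b" using m(2)[of b] b by simp
      ultimately show ?thesis by (auto simp: comparable_def)
    qed
    moreover have "m \<in> carrier L" using m(1) sub(1) by (rule subsetD[rotated])
    ultimately obtain c where c: "c \<in> carrier L" "\<And>b. b \<in> B \<Longrightarrow> c \<sqsubseteq>\<^bsub>L\<^esub> b"
      "\<And>x. x \<in> carrier L \<Longrightarrow> (\<And>b. b \<in> B \<Longrightarrow> x \<sqsubseteq>\<^bsub>L\<^esub> b) \<Longrightarrow> x \<sqsubseteq>\<^bsub>L\<^esub> c"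
      using hat_greatest_lower_bound[OF L sub(2) AB(3), of m] by metis
    have "c \<in> ?N B" using c(1,2) by (simp add: common_def comparable_def)
    moreover have "comparable L a c" if a: "a \<in> A" for a
    proof (cases "\<forall>b\<in>B. a \<sqsubseteq>\<^bsub>L\<^esub> b")
      case True
      then show ?thesis using c(3)[of a] a sub(1) by (auto simp: comparable_def)
    next
      case False
      then obtain b where b: "b \<in> B" "\<not> a \<sqsubseteq>\<^bsub>L\<^esub> b" by blast
      moreover have "comparable L a b" using a b(1) AB(2) by (auto simp: common_def)
      ultimately have "b \<sqsubseteq>\<^bsub>L\<^esub> a" by (simp add: comparable_def)
      then have "c \<sqsubseteq>\<^bsub>L\<^esub> a"
        by (rule le_trans[OF c(2)[OF b(1)] _ c(1)]) (use sub a b(1) in auto)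
      then show ?thesis by (simp add: comparable_def)
    qed
    then have "c \<in> ?N A" using c(1) by (simp add: common_def)
    ultimately show ?thesis using AB(1,2) by blast
  qed
  have A': "A \<noteq> {}" "A \<subseteq> carrier L" "?N A \<noteq> {}" "?N (?N A) = A"
    using A by (auto simp: closed_sets_def)
  have NA: "?N A \<subseteq> carrier L" by (auto simp: common_def)
  have "finite (A \<union> ?N A)"
    using L A'(2) NA finite_subset[of "A \<union> ?N A" "carrier L"] by (simp add: finite_semilattice_def)
  moreover have "A \<union> ?N A \<noteq> {}" "A \<union> ?N A \<subseteq> carrier L" using A' NA by simp_all
  ultimately obtain m where m: "m \<in> A \<union> ?N A" "\<And>x. x \<in> A \<union> ?N A \<Longrightarrow> x \<sqsubseteq>\<^bsub>L\<^esub> m \<Longrightarrow> x = m"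
    using finite_minimal_element[OF partial_order_axioms, of "A \<union> ?N A"] by metis
  show ?thesis
  proof (cases "m \<in> A")
    case True
    then show ?thesis using A' m(2) by (intro step[of A "?N A" m]) simp_all
  next
    case False
    then have "?N A \<inter> A \<noteq> {}"
      using A' m by (intro step[of "?N A" A m]) (simp_all add: Un_commute)
    then show ?thesis by (simp add: Int_commute)
  qed
qed

section \<open>From the compatibility graph to comparability\<close>

lemma CN_compatibility_graph:
  assumes C: "monotone_involution L C" and A: "A \<subseteq> carrier L"
  shows "CN (compatibility_graph L C) A = C ` common (carrier L) (comparable L) A"
proof -
  have C': "C x \<in> carrier L" "C (C x) = x" if "x \<in> carrier L" for x
    using C that by (auto simp: monotone_involution_def)
  have mono: "C x \<sqsubseteq>\<^bsub>L\<^esub> C y" if "x \<sqsubseteq>\<^bsub>L\<^esub> y" "x \<in> carrier L" "y \<in> carrier L" for x y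
    using C that by (auto simp: monotone_involution_def)
  \<comment> \<open>Applying \<open>C\<close> to the first alternative gives that \<open>C v\<close>
    is below \<open>a\<close>, which together with the second is comparability of \<open>a\<close>
    and \<open>C v\<close>.\<close>
  have adj: "v \<sqsubseteq>\<^bsub>L\<^esub> C a \<or> a \<sqsubseteq>\<^bsub>L\<^esub> C v \<longleftrightarrow> comparable L a (C v)" if "a \<in> carrier L" "v \<in> carrier L" for a v
    using that mono[of v "C a"] mono[of "C v" a] C' by (auto simp: comparable_def)
  have "v \<in> CN (compatibility_graph L C) A \<longleftrightarrow> v \<in> carrier L \<and> C v \<in> common (carrier L) (comparable L) A" for v
    using adj[of _ v] A C'(1)[of v] by (auto simp: CN_def compatibility_graph_def common_def)
  moreover have "v \<in> carrier L \<and> C v \<in> common (carrier L) (comparable L) A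
      \<longleftrightarrow> v \<in> C ` common (carrier L) (comparable L) A" for v
  proof
    assume "v \<in> carrier L \<and> C v \<in> common (carrier L) (comparable L) A"
    then show "v \<in> C ` common (carrier L) (comparable L) A" using C'(2)[of v] by (metis imageI)
  qed (use C' in \<open>auto simp: common_def\<close>)
  ultimately show ?thesis by (intro Set.set_eqI) (simp only:)
qed

theorem theorem6p4:
  fixes L :: "('a, 'm) gorder_scheme" and C :: "'a \<Rightarrow> 'a"
  assumes "free_I_semilattice L C" and "fat_intervals L"
  shows "z2_homotopy_equivalent (graph_complex (compatibility_graph L C)) (order_complex L C)"
proof -
  let ?G = "compatibility_graph L C"
  have L: "finite_semilattice L" and C: "monotone_involution L C"
    using assms(1) by (auto simp: free_I_semilattice_def)
  interpret involutive_graph "carrier L" "comparable L" C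
  proof
    show "finite (carrier L)" using L by (simp add: finite_semilattice_def)
    show "comparable L y x" if "comparable L x y" for x y
      using that by (auto simp: comparable_def)
    show "involution_on (carrier L) C"
      using C by (simp add: monotone_involution_def involution_on_def)
    show "comparable L (C x) (C y)" if "x \<in> carrier L" "y \<in> carrier L" "comparable L x y" for x y
      using C that by (auto simp: monotone_involution_def comparable_def)
    show "A \<inter> common (carrier L) (comparable L) A \<noteq> {}"
      if "A \<in> closed_sets (carrier L) (comparable L)" for A
      by (rule comparable_core_nonempty[OF L that])
  qed
  have CN: "CN ?G A = star A" if "A \<subseteq> carrier L" for A
    by (rule CN_compatibility_graph[OF C that])
  have CNCN: "CN ?G (CN ?G A) = N (N A)" if "A \<subseteq> carrier L" for A
    using CN[OF that] CN[OF C_subset[OF N_subset]] by (simp add: N_C N_subset C_C)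
  have "A \<in> P_graph ?G \<and> CN ?G (CN ?G A) = A \<longleftrightarrow> A \<in> Q" for A
    using CN[of A] CNCN[of A] by (auto simp: P_graph_def closed_sets_def compatibility_graph_def)
  then have car: "carrier (closed_poset ?G) = Q" by (simp add: closed_poset_def)
  have cmp: "comparable (closed_poset ?G) A B \<longleftrightarrow> A \<subseteq> B \<or> B \<subseteq> A" for A B
    by (simp add: comparable_def closed_poset_def)
  have "chains (closed_poset ?G) = flags"
    unfolding chains_def flags_def chain_subset_def car cmp
    by (intro Collect_cong conj_cong refl iffI) (auto intro: finite_subset[OF _ finite_Q])
  \<comment> \<open>\<open>CN\<close> and \<open>star\<close> are known to agree only on subsets of
    the carrier, but \<open>affine_extension\<close> evaluates them only on members of
    \<open>Q\<close>.\<close>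
  moreover have "affine_extension Q (CN ?G) = affine_extension Q star"
  proof -
    have "{A \<in> Q. CN ?G A = B} = {A \<in> Q. star A = B}" for B
      using CN QD(2) by auto
    then show ?thesis by (simp add: affine_extension_def fun_eq_iff)
  qed
  ultimately have "graph_complex ?G = flag_space"
    by (simp add: graph_complex_def order_complex_def car)
  moreover have "s \<in> chains L \<longleftrightarrow> s \<in> cliques" for s
    using finite_subset[OF _ finite_X, of s] unfolding chains_def cliques_def
    by (auto simp: common_def subset_iff)
  then have "chains L = cliques" by (rule Set.set_eqI)
  then have "order_complex L C = clique_space" by (simp add: order_complex_def)
  ultimately show ?thesis using flag_clique_equivalence by simp
qed

end
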